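(* Let $n$ be a positive integer. The number of $n\times n$ diagonally symmetric alternating sign matrices is given by $$|\mathrm{DSASM}(n)|=\operatorname*{Pf}_{\chi_{\mathrm{odd}}(n)\le i<j\le n-1}\biggl([u^iv^j]\,\frac{(v-u)(2+uv)}{(1-uv)(1-u-v)}\biggr),$$ where the coefficients which comprise the entries for the Pfaffian are given explicitly, for $0\le i<j$, by $$\begin{aligned}[u^iv^j]\,\frac{(v-u)(2+uv)}{(1-uv)(1-u-v)}&=\sum_{k=0}^i(3-\delta_{k,0})\biggl(\binom{i+j-2k-1}{i-k}-\binom{i+j-2k-1}{j-k}\biggr)\\ &=(j-i)\sum_{k=0}^i\frac{3-\delta_{k,0}}{i+j-2k}\binom{i+j-2k}{i-k}.\end{aligned}$$
   Context: An alternating sign matrix (ASM) is a square matrix with entries in $\{0,1,-1\}$ such that along each row and each column the nonzero entries alternate in sign and have sum $1$. A diagonally symmetric alternating sign matrix (DSASM) is an ASM which equals its transpose. $\mathrm{DSASM}(n)$ denotes the set of $n\times n$ DSASMs. Conventions: $\chi_{\mathrm{odd}}(n)$ is $1$ if $n$ is odd and $0$ if $n$ is even. $\delta_{i,j}$ is the Kronecker delta. $[u^iv^j]f(u,v)$ is the coefficient of $u^iv^j$ in the power series expansion of $f$ about $u=v=0$. For integers $n,k$, $\binom nk=\frac{n!}{k!(n-k)!}$ if $0\le k\le n$, and $\binom nk=0$ otherwise. $\operatorname{Pf}_{a\le i<j\le b}(B_{ij})$ is the Pfaffian of the skew-symmetric matrix with rows and columns indexed by $a,\ldots,b$ whose strictly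 upper triangular part is $(B_{ij})_{a\le i<j\le b}$; an empty Pfaffian is $1$. *)

theory Defs
  imports
    "Jordan_Normal_Form.Matrix"
    "HOL-Combinatorics.Permutations"
    "HOL-Computational_Algebra.Formal_Power_Series"
begin

section \<open>Alternating sign matrices\<close>

definition alternating_line :: "int list \<Rightarrow> bool" where
  "alternating_line xs \<longleftrightarrow>
     set xs \<subseteq> {0, 1, -1} \<and>
     successively (\<lambda>x y. sgn x = - sgn y) (filter (\<lambda>x. x \<noteq> 0) xs) \<and>
     sum_list xs = 1"

definition is_ASM :: "int mat \<Rightarrow> bool" where
  "is_ASM A \<longleftrightarrow>
     square_mat A \<and>
     (\<forall>i < dim_row A. alternating_line (list_of_vec (row A i))) \<and>
     (\<forall>j < dim_col A. alternating_line (list_of_vec (col A j)))"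

definition DSASM :: "nat \<Rightarrow> int mat set" where
  "DSASM n = {A \<in> carrier_mat n n. is_ASM A \<and> transpose_mat A = A}"

section \<open>Pfaffians\<close>

definition skew_extension :: "(nat \<Rightarrow> nat \<Rightarrow> 'a) \<Rightarrow> nat \<Rightarrow> nat \<Rightarrow> 'a::ring_1" where
  "skew_extension B i j = (if i < j then B i j else if j < i then - B j i else 0)"

text \<open>
  The Pfaffian of the matrix \<open>A\<close> with rows and columns indexed by \<open>a, \<dots>, b\<close>:
  for size \<open>2m\<close> it is \<open>1 / (2 ^ m m!)\<close> times the sum over all permutations \<open>\<sigma>\<close> of the
  index set of \<open>sgn \<sigma>\<close> times the product of the entries of \<open>A\<close> at
  \<open>(\<sigma> a, \<sigma> (a + 1))\<close>, \<open>(\<sigma> (a + 2), \<sigma> (a + 3))\<close>, and so on.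
  If \<open>b < a\<close> the index set is empty and the value is \<open>1\<close>.
\<close>

definition pfaffian :: "nat \<Rightarrow> nat \<Rightarrow> (nat \<Rightarrow> nat \<Rightarrow> 'a) \<Rightarrow> 'a::field_char_0" where
  "pfaffian a b A =
     (if even (card {a..b}) then
        (let m = card {a..b} div 2 in
           (\<Sum>\<sigma> | \<sigma> permutes {a..b}.
              of_int (sign \<sigma>) * (\<Prod>k<m. A (\<sigma> (a + 2 * k)) (\<sigma> (a + 2 * k + 1))))
           / (2 ^ m * fact m))
      else 0)"

definition Pf :: "nat \<Rightarrow> nat \<Rightarrow> (nat \<Rightarrow> nat \<Rightarrow> 'a) \<Rightarrow> 'a::field_char_0" where
  "Pf a b B = pfaffian a b (skew_extension B)"

lemma Pf_empty: "b < a \<Longrightarrow> Pf a b B = 1"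
  by (simp add: Pf_def pfaffian_def permutes_empty)

section \<open>Power series in two variables\<close>

text \<open>
  Power series in \<open>u\<close> and \<open>v\<close> over the rationals are power series in \<open>v\<close> whose
  coefficients are power series in \<open>u\<close>.
\<close>

definition u_var :: "rat fps fps" where "u_var = fps_const fps_X"

definition v_var :: "rat fps fps" where "v_var = fps_X"

definition coeff_uv :: "nat \<Rightarrow> nat \<Rightarrow> rat fps fps \<Rightarrow> rat" where
  "coeff_uv i j f = fps_nth (fps_nth f j) i"

lemma coeff_uv_monomial:
  "coeff_uv i j (u_var ^ p * v_var ^ q) = (if i = p \<and> j = q then 1 else 0)"
  by (auto simp: coeff_uv_def u_var_def v_var_def fps_const_power fps_X_power_nth)

definition dsasm_gf :: "rat fps fps" where
  "dsasm_gf = ((v_var - u_var) * (2 + u_var * v_var))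
              / ((1 - u_var * v_var) * (1 - u_var - v_var))"

text \<open>
  The coefficient ring \<open>rat fps\<close> is not a field, so the division of \<open>rat fps fps\<close> is
  meaningful only for suitable denominators.  The one used here has the invertible constant
  term \<open>1 - u\<close>, and the quotient is the genuine one.
\<close>

lemma dsasm_gf_times_denominator:
  "dsasm_gf * ((1 - u_var * v_var) * (1 - u_var - v_var)) = (v_var - u_var) * (2 + u_var * v_var)"
proof -
  let ?g = "(1 - u_var * v_var) * (1 - u_var - v_var)"
  have g0: "fps_nth ?g 0 = 1 - fps_X"
    by (simp add: u_var_def v_var_def)
  have "fps_nth (1 - fps_X :: rat fps) 0 \<noteq> 0" by simp
  then have inv: "inverse (1 - fps_X) * (1 - fps_X :: rat fps) = 1"
    by (rule inverse_mult_eq_1)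
  have "(1 - fps_X :: rat fps) \<noteq> 0"
    using inv by (metis mult_zero_right zero_neq_one)
  then have sd: "subdegree ?g = 0"
    using g0 by (simp add: subdegree_eq_0_iff)
  have "fps_nth ?g 0 * inverse (fps_nth ?g 0) = 1"
    unfolding g0 using inv by (simp only: mult.commute)
  then have "?g * fps_right_inverse ?g (inverse (fps_nth ?g 0)) = 1"
    by (rule fps_right_inverse)
  then have "?g * inverse ?g = 1"
    by (simp only: fps_inverse_def[of ?g])
  moreover have "x * inverse y * y = x" if "y * inverse y = 1" for x y :: "rat fps fps"
    using that by (simp add: mult.assoc mult.commute[of "inverse y"])
  ultimately show ?thesis
    unfolding dsasm_gf_def fps_divide_unit'[OF sd] by blast
qed

definition chi_odd :: "nat \<Rightarrow> nat" where
  "chi_odd n = (if odd n then 1 else 0)"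

definition kronecker_delta :: "nat \<Rightarrow> nat \<Rightarrow> rat" where
  "kronecker_delta i j = (if i = j then 1 else 0)"

end

theory Submission
  imports Defs "Jordan_Normal_Form.Determinant"
begin

text \<open>
  A diagonally symmetric alternating sign matrix is determined by its entries on and above the
  diagonal.  Recording at each place whether the partial line sum is \<open>0\<close> or \<open>1\<close> turns these
  entries into a configuration of a six-vertex model on a triangle, in which line \<open>i\<close> runs down
  column \<open>i\<close> to the diagonal and then along row \<open>i\<close>.  Line \<open>i\<close> carries a parameter \<open>x\<^sub>i\<close>, and the
  vertex on lines \<open>x\<close> and \<open>y\<close> gets a weight which depends on its entry and on the two partial sums:
  \<open>1 - x y\<close> or \<open>1 - x - y\<close> for an entry \<open>0\<close>, \<open>1\<close> for an entry \<open>1\<close>, and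
  \<open>(1 - x + x\<^sup>2) (1 - y + y\<^sup>2)\<close> for an entry \<open>-1\<close>; on the diagonal the weights are \<open>1 + x\<close>, \<open>1\<close> and
  \<open>1 - x + x\<^sup>2\<close>.  With \<open>a = 1 - x y\<close>, \<open>b = 1 - x - y\<close> and \<open>c\<^sup>2 = (1 - x + x\<^sup>2) (1 - y + y\<^sup>2)\<close> one has
  \<open>a\<^sup>2 - a b + b\<^sup>2 = c\<^sup>2\<close>: this is a rational parametrisation of the combinatorial point of the
  six-vertex model.  All weights are \<open>1\<close> when the parameters vanish, so the partition function
  \<open>Z\<close> specialises to the number of matrices (\<open>card_DSASM\<close>).

  The weights satisfy the Yang--Baxter and reflection equations, hence \<open>Z\<close> is symmetric in its
  parameters (\<open>partition_fn_swap\<close>).  As a polynomial in \<open>x\<^sub>1\<close> it has degree at most \<open>n - 1\<close>.  For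
  \<open>x\<^sub>1 = -1\<close> the first line is frozen and \<open>Z\<close> reduces to size \<open>n - 1\<close>; for \<open>x\<^sub>1 + x\<^sub>n = 1\<close> the
  vertex in the corner is frozen and \<open>Z\<close> reduces to size \<open>n - 2\<close>.  This determines \<open>Z\<close>
  (\<open>pfaffian_identity_generic\<close>):

  \<open>Z \<Prod>\<^sub>i\<^sub><\<^sub>j (x\<^sub>j - x\<^sub>i) = \<Prod>\<^sub>i\<^sub><\<^sub>j (1 - x\<^sub>i x\<^sub>j) (1 - x\<^sub>i - x\<^sub>j) Pf (f (x\<^sub>i, x\<^sub>j))\<close>, where
  \<open>f (u, v) = (v - u) (2 + u v) / ((1 - u v) (1 - u - v))\<close>,

  and where for odd \<open>n\<close> the matrix gets an additional first row of ones.  The product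
  on the right cancels the denominators that contain \<open>x\<^sub>1\<close>, so that both sides are polynomials in
  \<open>x\<^sub>1\<close> of degree at most \<open>2 (n - 1)\<close>, and they agree at the \<open>2 n - 1\<close> points \<open>x\<^sub>j\<close> and \<open>1 - x\<^sub>j\<close> with \<open>j > 1\<close>, and \<open>-1\<close>.

  Letting all parameters tend to \<open>0\<close> gives the enumeration.  Put \<open>x\<^sub>i = i t\<close> in the ring of power
  series in \<open>t\<close> and compare the coefficients of \<open>t\<close> to the power \<open>n (n - 1) / 2\<close>.  On the left this
  is the number of matrices times a Vandermonde product.  On the right the Pfaffian expands, in the
  manner of the Cauchy--Binet formula, into minors of a Vandermonde matrix times products of
  coefficients of \<open>f\<close>; only the exponents \<open>0, \<dots>, n - 1\<close> in some order contribute to this power,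
  so that the same Vandermonde product times the Pfaffian of the coefficients remains
  (\<open>pfaffian_sum_leading_coeff\<close>).
\<close>

section \<open>A six-vertex model on a triangle\<close>

text \<open>
  The product of these factors for the two lines through a vertex is the squared weight \<open>c\<^sup>2\<close> of
  the six-vertex model; a gauge transformation has moved it entirely to the entries \<open>-1\<close>.
\<close>

definition turn_factor :: "'a::comm_ring_1 \<Rightarrow> 'a" where
  "turn_factor x = 1 - x + x\<^sup>2"

text \<open>
  One row of the triangle, to the right of the diagonal.  The Boolean \<open>h\<close> is the partial sum of the
  row so far and the word \<open>bs\<close> lists the partial sums of the columns above the row; an entry is
  the common change of both.  The function \<open>F\<close> weighs the word that leaves the row at the bottom,
  and the row has to end with sum \<open>1\<close>.
\<close>

fun row_transfer :: "'a::comm_ring_1 \<Rightarrow> bool \<Rightarrow> 'a list \<Rightarrow> (bool list \<Rightarrow> 'a) \<Rightarrow> bool list \<Rightarrow> 'a" where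
  "row_transfer x h (y # ys) F (b # bs) =
     (if h = b
      then (1 - x * y) * row_transfer x h ys (\<lambda>w. F (b # w)) bs
           + (if b then turn_factor x * turn_factor y else 1) * row_transfer x (\<not> h) ys (\<lambda>w. F ((\<not> b) # w)) bs
      else (1 - x - y) * row_transfer x h ys (\<lambda>w. F (b # w)) bs)"
| "row_transfer x h _ F _ = (if h then F [] else 0)"

definition diag_weight :: "'a::comm_ring_1 \<Rightarrow> bool \<Rightarrow> bool \<Rightarrow> 'a" where
  "diag_weight x b h = (if b = h then 1 + x else if b then turn_factor x else 1)"

text \<open>
  By symmetry of the matrix the partial sum \<open>b\<close> of a column above the diagonal is also the partial
  sum of the row left of the diagonal.
\<close>

fun triangle_weight :: "'a::comm_ring_1 list \<Rightarrow> bool list \<Rightarrow> 'a" where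
  "triangle_weight (x # xs) (b # bs) =
     diag_weight x b False * row_transfer x False xs (triangle_weight xs) bs
     + diag_weight x b True * row_transfer x True xs (triangle_weight xs) bs"
| "triangle_weight _ _ = 1"

text \<open>
  Linearity lets local relations between vertex weights act inside a whole row.
\<close>

lemma row_transfer_lin:
  "row_transfer x h ys (\<lambda>w. k * F w + l * G w) bs = k * row_transfer x h ys F bs + l * row_transfer x h ys G bs"
proof (induction x h ys F bs arbitrary: G rule: row_transfer.induct)
  case (1 x h y ys F b bs)
  show ?case
    using 1(1)[where G = "\<lambda>w. G (b # w)"] 1(2)[where G = "\<lambda>w. G ((\<not> b) # w)"] 1(3)[where G = "\<lambda>w. G (b # w)"]
    by (simp add: algebra_simps)
qed auto

lemma row_transfer_scale: "row_transfer x h ys (\<lambda>w. k * F w) bs = k * row_transfer x h ys F bs"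
  using row_transfer_lin[of x h ys k F 0 F bs] by simp

lemma row_transfer_add: "row_transfer x h ys (\<lambda>w. F w + G w) bs = row_transfer x h ys F bs + row_transfer x h ys G bs"
  using row_transfer_lin[of x h ys 1 F 1 G bs] by simp

lemma row_transfer_cong:
  assumes "\<And>w. length w = length ys \<Longrightarrow> F w = G w" "length bs = length ys"
  shows "row_transfer x h ys F bs = row_transfer x h ys G bs"
  using assms
proof (induction x h ys F bs arbitrary: G rule: row_transfer.induct)
  case (1 x h y ys F b bs)
  show ?case
    using 1(1)[of "\<lambda>w. G (b # w)"] 1(2)[of "\<lambda>w. G ((\<not> b) # w)"] 1(3)[of "\<lambda>w. G (b # w)"] 1(4,5)
    by simp
qed auto

section \<open>The exchange relation and symmetry\<close>

text \<open>
  The R-matrix of the six-vertex model between neighbouring lines \<open>x\<close> and \<open>y\<close>.  It commutes with the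
  number of ones, and at \<open>x = y\<close> it is a multiple of the identity.
\<close>

definition R_matrix :: "'a::comm_ring_1 \<Rightarrow> 'a \<Rightarrow> bool \<Rightarrow> bool \<Rightarrow> (bool \<Rightarrow> bool \<Rightarrow> 'a) \<Rightarrow> 'a" where
  "R_matrix x y b c F =
     (if b = c then (1 - y + x * y) * F b c
      else (if b then turn_factor y else turn_factor x) * F b c + (x - y) * F c b)"

text \<open>
  The Yang--Baxter equation for two columns that cross a row: applying the R-matrix above the row
  has the same effect as applying it below, with the columns interchanged.
\<close>

lemma exchange_row_head:
  "R_matrix y z b c (\<lambda>b c. row_transfer x h (y # z # ys) F (b # c # bs)) =
   row_transfer x h (z # y # ys) (\<lambda>w. case w of b # c # w \<Rightarrow> R_matrix y z b c (\<lambda>b c. F (b # c # w)) | _ \<Rightarrow> 0) (b # c # bs)"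
  apply (cases b; cases c; cases h)
  apply (simp_all add: R_matrix_def row_transfer_lin row_transfer_scale)
  apply (simp_all add: turn_factor_def power2_eq_square algebra_simps)
  done

text \<open>
  The R-matrix acting on two neighbouring letters of a word.
\<close>

fun R_matrix_at :: "nat \<Rightarrow> 'a::comm_ring_1 \<Rightarrow> 'a \<Rightarrow> (bool list \<Rightarrow> 'a) \<Rightarrow> bool list \<Rightarrow> 'a" where
  "R_matrix_at 0 x y F (b # c # w) = R_matrix x y b c (\<lambda>b c. F (b # c # w))"
| "R_matrix_at (Suc n) x y F (b # w) = R_matrix_at n x y (\<lambda>w. F (b # w)) w"
| "R_matrix_at _ _ _ _ _ = 0"

lemma R_matrix_at_lin:
  "R_matrix_at n x y (\<lambda>w. k * F w + l * G w) bs = k * R_matrix_at n x y F bs + l * R_matrix_at n x y G bs"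
proof (induction n x y F bs arbitrary: G rule: R_matrix_at.induct)
  case (1 x y F b c w)
  show ?case by (simp add: R_matrix_def algebra_simps)
qed simp_all

lemma R_matrix_at_scale: "R_matrix_at n x y (\<lambda>w. k * F w) bs = k * R_matrix_at n x y F bs"
  using R_matrix_at_lin[of n x y k F 0 F bs] by simp

lemma R_matrix_at_add: "R_matrix_at n x y (\<lambda>w. F w + G w) bs = R_matrix_at n x y F bs + R_matrix_at n x y G bs"
  using R_matrix_at_lin[of n x y 1 F 1 G bs] by simp

lemma exchange_row:
  assumes "length bs = length p + 2 + length r"
  shows "R_matrix_at (length p) y z (row_transfer x h (p @ y # z # r) F) bs =
         row_transfer x h (p @ z # y # r) (R_matrix_at (length p) y z F) bs"
  using assms
proof (induction p arbitrary: h F bs)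
  case Nil
  then obtain b c w where bs: "bs = b # c # w" "length w = length r"
    by (cases bs; cases "tl bs") auto
  show ?case
    unfolding bs list.size append.simps R_matrix_at.simps exchange_row_head
    by (rule row_transfer_cong) (auto simp: bs split: list.splits)
next
  case (Cons q p)
  then obtain b w where bs: "bs = b # w" and len: "length w = length p + 2 + length r"
    by (cases bs) auto
  show ?case
    using Cons.IH[OF len] by (simp add: bs R_matrix_at_add R_matrix_at_scale)
qed

text \<open>
  The Yang--Baxter equation for two rows that cross the same columns, telescoped along the columns.
  At the right end both rows have sum \<open>1\<close>, where the R-matrix acts as the scalar \<open>1 - y + x y\<close>.
\<close>

lemma exchange_two_rows:
  assumes "length bs = length r"
  shows "R_matrix x y h g (\<lambda>h g. row_transfer x h r (\<lambda>w. row_transfer y g r F w) bs) =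
         (1 - y + x * y) * row_transfer y h r (\<lambda>w. row_transfer x g r F w) bs"
  using assms
proof (induction r arbitrary: h g F bs)
  case Nil
  then show ?case by (simp add: R_matrix_def)
next
  case (Cons z r)
  then obtain b w where bs: "bs = b # w" and len: "length w = length r"
    by (cases bs) auto
  note IH = Cons.IH[OF len]
  define R where "R c h g = row_transfer x h r (\<lambda>w. row_transfer y g r (\<lambda>w. F (c # w)) w) w" for c h g
  define R' where "R' c h g = row_transfer y h r (\<lambda>w. row_transfer x g r (\<lambda>w. F (c # w)) w) w" for c h g
  have IH: "R_matrix x y h g (R c) = (1 - y + x * y) * R' c h g" for c h g
    using IH[of h g "\<lambda>w. F (c # w)"] unfolding R_def R'_def .
  have e: "(1 - y + x * y) * R' c False False = (1 - y + x * y) * R c False False"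
    "(1 - y + x * y) * R' c True True = (1 - y + x * y) * R c True True"
    "(1 - y + x * y) * R' c False True = turn_factor x * R c False True + (x - y) * R c True False"
    "(1 - y + x * y) * R' c True False = turn_factor y * R c True False + (x - y) * R c False True" for c
    unfolding IH[symmetric] by (simp_all add: R_matrix_def)
  show ?case
    unfolding bs
    apply (cases b; cases h; cases g)
    apply (simp_all add: R_matrix_def row_transfer_add row_transfer_scale R_def[symmetric] R'_def[symmetric])
    apply (simp_all add: distrib_left mult.left_commute[of "1 - y + x * y"] e)
    apply (simp_all add: turn_factor_def power2_eq_square algebra_simps)
    done
qed

text \<open>
  The reflection equation: the two crossing lines are pulled through the two diagonal vertices and
  the vertex between them, which moves the R-matrix from the columns to the rows.
\<close>

lemma exchange_triangle_head:
  assumes "length bs = length r"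
  shows "R_matrix x y b c (\<lambda>b c. triangle_weight (x # y # r) (b # c # bs)) =
         (1 - y + x * y) * triangle_weight (y # x # r) (b # c # bs)"
proof -
  define R where "R h g = row_transfer x h r (\<lambda>w. row_transfer y g r (triangle_weight r) w) bs" for h g
  define R' where "R' h g = row_transfer y h r (\<lambda>w. row_transfer x g r (triangle_weight r) w) bs" for h g
  have two: "R_matrix x y h g R = (1 - y + x * y) * R' h g" for h g
    using exchange_two_rows[OF assms, of x y h g "triangle_weight r"] unfolding R_def R'_def .
  have e: "(1 - y + x * y) * R' False False = (1 - y + x * y) * R False False"
    "(1 - y + x * y) * R' True True = (1 - y + x * y) * R True True"
    "(1 - y + x * y) * R' False True = turn_factor x * R False True + (x - y) * R True False"
    "(1 - y + x * y) * R' True False = turn_factor y * R True False + (x - y) * R False True"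
    unfolding two[symmetric] by (simp_all add: R_matrix_def)
  show ?thesis
    apply (cases b; cases c)
    apply (simp_all add: R_matrix_def diag_weight_def row_transfer_add row_transfer_scale
        R_def[symmetric] R'_def[symmetric])
    apply (simp_all add: distrib_left mult.left_commute[of "1 - y + x * y"] e)
    apply (simp_all add: turn_factor_def power2_eq_square algebra_simps)
    done
qed

text \<open>
  The R-matrix descends through the rows above the two lines until the reflection equation applies.
\<close>

lemma exchange_triangle:
  assumes "length bs = length p + 2 + length r"
  shows "R_matrix_at (length p) x y (triangle_weight (p @ x # y # r)) bs =
         (1 - y + x * y) * triangle_weight (p @ y # x # r) bs"
  using assms
proof (induction p arbitrary: bs)
  case Nil
  then obtain b c w where "bs = b # c # w" "length w = length r"
    by (cases bs; cases "tl bs") auto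
  then show ?case using exchange_triangle_head[of w r x y b c] by simp
next
  case (Cons q p)
  then obtain b w where bs: "bs = b # w" and len: "length w = length p + 2 + length r"
    by (cases bs) auto
  have *: "R_matrix_at (length p) x y (row_transfer q h (p @ x # y # r) (triangle_weight (p @ x # y # r))) w
      = (1 - y + x * y) * row_transfer q h (p @ y # x # r) (triangle_weight (p @ y # x # r)) w" for h
    unfolding exchange_row[OF len] row_transfer_scale[symmetric]
    by (rule row_transfer_cong) (use Cons.IH len in simp_all)
  show ?case
    by (simp add: bs R_matrix_at_add R_matrix_at_scale *) (simp add: algebra_simps)
qed

definition partition_fn :: "'a::comm_ring_1 list \<Rightarrow> 'a" where
  "partition_fn xs = triangle_weight xs (replicate (length xs) False)"

lemma R_matrix_at_zero:
  "R_matrix_at n x y F (replicate (n + 2 + m) False) = (1 - y + x * y) * F (replicate (n + 2 + m) False)"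
  by (induction n arbitrary: F) (simp_all add: R_matrix_def)

text \<open>
  On a word of zeros the R-matrix is the scalar \<open>1 - y + x y\<close>, so the exchange relation becomes
  symmetry as soon as this scalar can be cancelled.
\<close>

lemma partition_fn_swap:
  fixes x y :: "'a::idom"
  assumes "1 - y + x * y \<noteq> 0"
  shows "partition_fn (p @ x # y # r) = partition_fn (p @ y # x # r)"
proof -
  let ?w = "replicate (length p + 2 + length r) False"
  have "(1 - y + x * y) * triangle_weight (p @ x # y # r) ?w = (1 - y + x * y) * triangle_weight (p @ y # x # r) ?w"
    using exchange_triangle[of ?w p r x y] unfolding R_matrix_at_zero by simp
  with assms show ?thesis by (simp add: partition_fn_def)
qed

section \<open>Polynomial functions of bounded degree\<close>

text \<open>
  The interpolation takes place in one parameter at a time, with the others fixed.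
\<close>

definition poly_bounded :: "nat \<Rightarrow> ('a::comm_ring_1 \<Rightarrow> 'a) \<Rightarrow> bool" where
  "poly_bounded d F \<longleftrightarrow> (\<exists>p. degree p \<le> d \<and> (\<forall>x. F x = poly p x))"

lemma poly_bounded_const [intro]: "poly_bounded d (\<lambda>_. c)"
  unfolding poly_bounded_def by (rule exI[of _ "[:c:]"]) simp

lemma poly_bounded_linear [intro]: "d \<ge> 1 \<Longrightarrow> poly_bounded d (\<lambda>x. a + b * x)"
  unfolding poly_bounded_def by (rule exI[of _ "[:a, b:]"]) (simp add: mult.commute)

lemma poly_bounded_mono: "poly_bounded d F \<Longrightarrow> d \<le> e \<Longrightarrow> poly_bounded e F"
  unfolding poly_bounded_def by force

lemma poly_bounded_add: "poly_bounded d F \<Longrightarrow> poly_bounded d G \<Longrightarrow> poly_bounded d (\<lambda>x. F x + G x)"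
  unfolding poly_bounded_def using degree_add_le poly_add by metis

lemma poly_bounded_mult:
  "poly_bounded d F \<Longrightarrow> poly_bounded e G \<Longrightarrow> poly_bounded (d + e) (\<lambda>x. F x * G x)"
  unfolding poly_bounded_def using degree_mult_le poly_mult add_mono order_trans by metis

lemma poly_bounded_sum:
  "(\<And>i. i \<in> I \<Longrightarrow> poly_bounded d (F i)) \<Longrightarrow> poly_bounded d (\<lambda>x. \<Sum>i\<in>I. F i x)"
  by (induction I rule: infinite_finite_induct) (auto intro: poly_bounded_add)

lemma poly_bounded_prod_list:
  "(\<And>y. poly_bounded k (F y)) \<Longrightarrow> poly_bounded (k * length ys) (\<lambda>x. \<Prod>y\<leftarrow>ys. F y x)"
  by (induction ys) (auto intro: poly_bounded_mult)

lemma poly_bounded_prod: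
  "finite I \<Longrightarrow> (\<And>y. y \<in> I \<Longrightarrow> poly_bounded k (F y)) \<Longrightarrow> poly_bounded (k * card I) (\<lambda>x. \<Prod>y\<in>I. F y x)"
  by (induction I rule: finite_induct) (auto intro: poly_bounded_mult)

lemma poly_bounded_eqI:
  fixes F :: "'a::idom \<Rightarrow> 'a"
  assumes "poly_bounded d F" "poly_bounded d G" "finite S" "card S > d" "\<And>x. x \<in> S \<Longrightarrow> F x = G x"
  shows "F x = G x"
proof -
  obtain p q where p: "degree p \<le> d" "\<And>x. F x = poly p x" and q: "degree q \<le> d" "\<And>x. G x = poly q x"
    using assms(1,2) unfolding poly_bounded_def by blast
  have "p = q"
    by (rule poly_eqI_degree[of S]) (use p q assms in auto)
  then show ?thesis using p q by simp
qed

section \<open>Degree and special values of the partition function\<close>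

text \<open>
  A row with partial sum \<open>1\<close> that meets only columns with sum \<open>0\<close> admits no nonzero entry.
\<close>

lemma row_transfer_True_zero:
  "length ys = n \<Longrightarrow> row_transfer x True ys F (replicate n False) = (\<Prod>y\<leftarrow>ys. 1 - x - y) * F (replicate n False)"
  by (induction ys arbitrary: n F) auto

text \<open>
  The weight \<open>1 + x\<close> of the diagonal entry \<open>0\<close> vanishes at \<open>x = -1\<close>, so the first row is
  \<open>1, 0, \<dots>, 0\<close>.
\<close>

lemma partition_fn_minus_one:
  "partition_fn ((-1) # ys) = (\<Prod>y\<leftarrow>ys. 2 - y) * partition_fn ys"
  by (simp add: partition_fn_def diag_weight_def row_transfer_True_zero)

text \<open>
  If \<open>x + z = 1\<close>, then the weight \<open>1 - x - z\<close> in the last column vanishes.  The \<open>1\<close> of the row must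
  therefore stand in the last column.
\<close>

lemma row_transfer_corner_zero:
  assumes "x + z = 1"
  shows "row_transfer x True (ys @ [z]) F (replicate (Suc (length ys)) False) = 0"
    "row_transfer x False (ys @ [z]) F (replicate (Suc (length ys)) False) =
       (\<Prod>y\<leftarrow>ys. 1 - x * y) * F (replicate (length ys) False @ [True])"
proof -
  have z: "1 - x - z = 0" using assms by (simp add: algebra_simps)
  show 1: "row_transfer x True (ys @ [z]) F (replicate (Suc (length ys)) False) = 0" for F ys
    by (subst row_transfer_True_zero) (simp_all add: z)
  show "row_transfer x False (ys @ [z]) F (replicate (Suc (length ys)) False) =
       (\<Prod>y\<leftarrow>ys. 1 - x * y) * F (replicate (length ys) False @ [True])"
  proof (induction ys arbitrary: F)
    case (Cons y ys)
    then show ?case using 1[of ys] by (simp add: mult.assoc)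
  qed simp
qed

text \<open>
  A column with partial sum \<open>1\<close> next to the right end, where every row has sum \<open>1\<close>, admits only
  entries \<open>0\<close>.
\<close>

lemma row_transfer_last_True:
  assumes "length bs = length ys"
  shows "row_transfer y h (ys @ [z]) F (bs @ [True]) = (1 - y * z) * row_transfer y h ys (\<lambda>w. F (w @ [True])) bs"
  using assms
proof (induction ys bs arbitrary: h F rule: list_induct2')
  case (4 y' ys b bs)
  then have "row_transfer y h (ys @ [z]) F (bs @ [True])
      = (1 - y * z) * row_transfer y h ys (\<lambda>w. F (w @ [True])) bs" for h F
    by simp
  then show ?case by simp (simp add: algebra_simps)
qed auto

lemma triangle_weight_last_True:
  assumes "length bs = length ys"
  shows "triangle_weight (ys @ [z]) (bs @ [True]) = (1 + z) * (\<Prod>y\<leftarrow>ys. 1 - y * z) * triangle_weight ys bs"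
  using assms
proof (induction ys arbitrary: bs)
  case (Cons y ys)
  then obtain b w where bs: "bs = b # w" and len: "length w = length ys"
    by (cases bs) auto
  have "row_transfer y h ys (\<lambda>w. triangle_weight (ys @ [z]) (w @ [True])) w =
      (1 + z) * (\<Prod>y\<leftarrow>ys. 1 - y * z) * row_transfer y h ys (triangle_weight ys) w" for h
    unfolding row_transfer_scale[symmetric]
    by (rule row_transfer_cong) (use Cons.IH len in simp_all)
  then show ?case using len by (simp add: bs row_transfer_last_True algebra_simps)
qed (simp add: diag_weight_def)

lemma prod_list_mult_map:
  fixes f g :: "'b \<Rightarrow> 'a::comm_monoid_mult"
  shows "(\<Prod>x\<leftarrow>xs. f x * g x) = (\<Prod>x\<leftarrow>xs. f x) * (\<Prod>x\<leftarrow>xs. g x)"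
  by (induction xs) (simp_all add: ac_simps)

text \<open>
  The corner is a \<open>1\<close>, which freezes the first row and the last column, and what remains is the
  triangle on the lines between them.
\<close>

lemma partition_fn_corner:
  assumes "x + z = 1"
  shows "partition_fn (x # ys @ [z]) =
    (1 + x) * (1 + z) * (\<Prod>y\<leftarrow>ys. (1 - x * y) * (1 - y * z)) * partition_fn ys"
  using row_transfer_corner_zero[OF assms, of ys "triangle_weight (ys @ [z])"]
  by (simp add: partition_fn_def diag_weight_def triangle_weight_last_True prod_list_mult_map mult_ac)

text \<open>
  The row operator itself has degree at most \<open>length ys - 1\<close>, with the value zero for the empty
  row; the factor \<open>1 + x\<close> in the second part expresses this without a truncated subtraction.
\<close>

lemma poly_bounded_row_op:
  "poly_bounded (length ys) (\<lambda>x. row_transfer x False ys F (replicate (length ys) False)) \<and>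
   poly_bounded (length ys) (\<lambda>x. (1 + x) * row_transfer x False ys F (replicate (length ys) False))"
proof (induction ys arbitrary: F)
  case (Cons y ys)
  let ?R = "\<lambda>x. row_transfer x False ys (\<lambda>w. F (False # w)) (replicate (length ys) False)"
  have T: "poly_bounded (length ys) (\<lambda>x. row_transfer x True ys G (replicate (length ys) False))" for G :: "bool list \<Rightarrow> 'a"
  proof -
    have "poly_bounded (1 * length ys + 0) (\<lambda>x. (\<Prod>y\<leftarrow>ys. (1 - y) + (-1) * x) * G (replicate (length ys) False))"
      by (intro poly_bounded_mult poly_bounded_prod_list poly_bounded_linear poly_bounded_const) simp
    then show ?thesis by (simp add: row_transfer_True_zero algebra_simps)
  qed
  have lin: "poly_bounded 1 (\<lambda>x. 1 + (- y) * x)" "poly_bounded 1 (\<lambda>x. 1 + 1 * x)"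
    by (rule poly_bounded_linear, simp)+
  have "poly_bounded (length ys + 1) (\<lambda>x. ?R x * (1 + (- y) * x) +
      row_transfer x True ys (\<lambda>w. F (True # w)) (replicate (length ys) False))"
    by (intro poly_bounded_add poly_bounded_mult lin poly_bounded_mono[OF T] conjunct1[OF Cons.IH]) simp
  moreover have "poly_bounded (length ys + 1) (\<lambda>x. (1 + x) * ?R x * (1 + (- y) * x) +
      row_transfer x True ys (\<lambda>w. F (True # w)) (replicate (length ys) False) * (1 + 1 * x))"
    by (intro poly_bounded_add poly_bounded_mult lin T conjunct2[OF Cons.IH])
  ultimately show ?case by (simp add: algebra_simps)
qed (auto)

lemma poly_bounded_partition_fn:
  "poly_bounded (length ys) (\<lambda>x. partition_fn (x # ys))"
proof -
  have "poly_bounded (length ys) (\<lambda>x. (1 + x) * row_transfer x False ys (triangle_weight ys) (replicate (length ys) False)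
     + 1 * (\<Prod>y\<leftarrow>ys. (1 - y) + (-1) * x) * triangle_weight ys (replicate (length ys) False))"
  proof (rule poly_bounded_add)
    have "poly_bounded (0 + 1 * length ys + 0) (\<lambda>x. 1 * (\<Prod>y\<leftarrow>ys. (1 - y) + (-1) * x) * triangle_weight ys (replicate (length ys) False))"
      by (intro poly_bounded_mult poly_bounded_prod_list poly_bounded_linear poly_bounded_const) simp
    then show "poly_bounded (length ys) (\<lambda>x. 1 * (\<Prod>y\<leftarrow>ys. (1 - y) + (-1) * x) * triangle_weight ys (replicate (length ys) False))"
      by simp
  qed (rule conjunct2[OF poly_bounded_row_op])
  then show ?thesis
    by (simp add: partition_fn_def diag_weight_def row_transfer_True_zero algebra_simps)
qed

section \<open>Pfaffians as sums over permutations\<close>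

text \<open>
  For even \<open>N = 2 m\<close> this is \<open>2\<^sup>m m!\<close> times the Pfaffian.  Leaving out the division keeps it
  available over every commutative ring.
\<close>

definition pfaffian_sum :: "nat \<Rightarrow> (nat \<Rightarrow> nat \<Rightarrow> 'a) \<Rightarrow> 'a::comm_ring_1" where
  "pfaffian_sum N A =
     (\<Sum>\<sigma> | \<sigma> permutes {..<N}. of_int (sign \<sigma>) * (\<Prod>k<N div 2. A (\<sigma> (2 * k)) (\<sigma> (2 * k + 1))))"

lemma pfaffian_sum_cong:
  assumes "\<And>i j. i < N \<Longrightarrow> j < N \<Longrightarrow> A i j = B i j"
  shows "pfaffian_sum N A = pfaffian_sum N B"
  unfolding pfaffian_sum_def
proof (intro sum.cong refl arg_cong2[of _ _ _ _ "(*)"] prod.cong)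
  fix \<sigma> k assume s: "\<sigma> \<in> {\<sigma>. \<sigma> permutes {..<N}}" and k: "k \<in> {..<N div 2}"
  have "2 * k < N" "2 * k + 1 < N" using k by auto
  then have "\<sigma> (2 * k) < N" "\<sigma> (2 * k + 1) < N"
    using s permutes_in_image[of \<sigma> "{..<N}"] by auto
  then show "A (\<sigma> (2 * k)) (\<sigma> (2 * k + 1)) = B (\<sigma> (2 * k)) (\<sigma> (2 * k + 1))"
    by (rule assms)
qed

lemma of_int_sign_sq [simp]: "of_int (sign p) * (of_int (sign p) * x) = (x::'a::comm_ring_1)"
  by (cases "evenperm p") (simp_all add: sign_def)

lemma pfaffian_sum_permute:
  assumes "\<tau> permutes {..<N}"
  shows "pfaffian_sum N (\<lambda>i j. A (\<tau> i) (\<tau> j)) = of_int (sign \<tau>) * pfaffian_sum N A"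
proof -
  have "of_int (sign \<tau>) * pfaffian_sum N (\<lambda>i j. A (\<tau> i) (\<tau> j)) =
    (\<Sum>\<sigma> | \<sigma> permutes {..<N}. of_int (sign (\<tau> \<circ> \<sigma>)) *
       (\<Prod>k<N div 2. A ((\<tau> \<circ> \<sigma>) (2 * k)) ((\<tau> \<circ> \<sigma>) (2 * k + 1))))"
    unfolding pfaffian_sum_def sum_distrib_left
  proof (intro sum.cong refl)
    fix \<sigma> assume "\<sigma> \<in> {\<sigma>. \<sigma> permutes {..<N}}"
    then have "sign (\<tau> \<circ> \<sigma>) = sign \<tau> * sign \<sigma>"
      using assms by (intro sign_compose) (auto simp: permutation_permutes)
    then show "of_int (sign \<tau>) * (of_int (sign \<sigma>) * (\<Prod>k<N div 2. A (\<tau> (\<sigma> (2 * k))) (\<tau> (\<sigma> (2 * k + 1)))))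
      = of_int (sign (\<tau> \<circ> \<sigma>)) * (\<Prod>k<N div 2. A ((\<tau> \<circ> \<sigma>) (2 * k)) ((\<tau> \<circ> \<sigma>) (2 * k + 1)))"
      by (simp add: mult.assoc)
  qed
  also have "\<dots> = pfaffian_sum N A"
    unfolding pfaffian_sum_def
    by (rule setum_permutations_compose_left[OF assms, symmetric])
  finally show ?thesis by (metis of_int_sign_sq)
qed


abbreviation pf_term :: "nat \<Rightarrow> (nat \<Rightarrow> nat \<Rightarrow> 'a::comm_ring_1) \<Rightarrow> (nat \<Rightarrow> nat) \<Rightarrow> 'a" where
  "pf_term N A \<sigma> \<equiv> of_int (sign \<sigma>) * (\<Prod>k<N div 2. A (\<sigma> (2 * k)) (\<sigma> (2 * k + 1)))"

text \<open>
  Permuting the factors \<open>A (\<sigma> (2 k), \<sigma> (2 k + 1))\<close> is an even permutation of the indices.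
\<close>

lemma pf_term_swap_blocks:
  assumes "\<sigma> permutes {..<N}" "2 * k + 1 < N"
  shows "pf_term N A (\<sigma> \<circ> (transpose 0 (2 * k) \<circ> transpose 1 (2 * k + 1))) = pf_term N A \<sigma>"
proof -
  let ?\<rho> = "transpose 0 (2 * k) \<circ> transpose 1 (2 * k + 1) :: nat \<Rightarrow> nat"
  have r: "?\<rho> (2 * l) = 2 * transpose 0 k l" "?\<rho> (2 * l + 1) = 2 * transpose 0 k l + 1" for l
  proof -
    have "(1::nat) \<noteq> 2 * l" "2 * k + 1 \<noteq> 2 * l" "2 * l \<noteq> Suc (2 * k)" for k l :: nat by presburger+
    then show "?\<rho> (2 * l) = 2 * transpose 0 k l" "?\<rho> (2 * l + 1) = 2 * transpose 0 k l + 1"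
      by (auto simp: transpose_def)
  qed
  have sr: "sign ?\<rho> = 1" and pr: "permutation ?\<rho>"
    by (simp_all add: sign_compose permutation_compose permutation_swap_id sign_swap_id)
  have ps: "permutation \<sigma>" using assms(1) by (auto simp: permutation_permutes)
  have s: "sign (\<sigma> \<circ> ?\<rho>) = sign \<sigma>" by (simp only: sign_compose[OF ps pr] sr mult_1_right)
  have "(\<Prod>l<N div 2. A ((\<sigma> \<circ> ?\<rho>) (2 * l)) ((\<sigma> \<circ> ?\<rho>) (2 * l + 1))) =
      (\<Prod>l<N div 2. A (\<sigma> (2 * transpose 0 k l)) (\<sigma> (2 * transpose 0 k l + 1)))"
    using r by (simp add: o_def)
  also have "\<dots> = (\<Prod>l<N div 2. A (\<sigma> (2 * l)) (\<sigma> (2 * l + 1)))"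
  proof (rule prod.permute[symmetric, unfolded o_def, of "transpose 0 k" _ "\<lambda>l. A (\<sigma> (2 * l)) (\<sigma> (2 * l + 1))"])
    show "transpose 0 k permutes {..<N div 2}"
      using assms(2) by (intro permutes_swap_id) auto
  qed
  finally have p: "(\<Prod>l<N div 2. A ((\<sigma> \<circ> ?\<rho>) (2 * l)) ((\<sigma> \<circ> ?\<rho>) (2 * l + 1))) =
      (\<Prod>l<N div 2. A (\<sigma> (2 * l)) (\<sigma> (2 * l + 1)))" .
  show ?thesis unfolding s p by (rule refl)
qed

text \<open>
  The sign of the transposition is compensated by the skew symmetry of one factor.
\<close>

lemma pf_term_swap_in_block:
  assumes "\<sigma> permutes {..<N}" "N \<ge> 2" and skew: "\<And>i j. A i j = - A j i"
  shows "pf_term N A (\<sigma> \<circ> transpose 0 1) = pf_term N A \<sigma>"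
proof -
  have ps: "permutation \<sigma>" using assms(1) by (auto simp: permutation_permutes)
  have s: "sign (\<sigma> \<circ> transpose 0 1) = - sign \<sigma>"
    by (simp add: sign_compose[OF ps permutation_swap_id] sign_swap_id)
  have r: "transpose 0 1 (2 * l) = 2 * l" "transpose 0 1 (2 * l + 1) = 2 * l + 1" if "l \<noteq> 0" for l :: nat
    using that by (auto simp: transpose_def)
  have z: "0 \<in> {..<N div 2}" using assms(2) by simp
  have "(\<Prod>l<N div 2. A ((\<sigma> \<circ> transpose 0 1) (2 * l)) ((\<sigma> \<circ> transpose 0 1) (2 * l + 1)))
     = A (\<sigma> 1) (\<sigma> 0) * (\<Prod>l\<in>{..<N div 2} - {0}. A (\<sigma> (2 * l)) (\<sigma> (2 * l + 1)))"
    by (subst prod.remove[OF _ z]) (use r in \<open>auto simp: o_def intro!: prod.cong\<close>)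
  also have "\<dots> = - (\<Prod>l<N div 2. A (\<sigma> (2 * l)) (\<sigma> (2 * l + 1)))"
    by (subst prod.remove[OF finite_lessThan z, of "\<lambda>l. A (\<sigma> (2 * l)) (\<sigma> (2 * l + 1))"]) (simp_all add: skew[of "\<sigma> (Suc 0)" "\<sigma> 0"])
  finally show ?thesis by (simp only: s) simp
qed

lemma permutes_fixing_first: "{\<sigma>. \<sigma> permutes {a..<N} \<and> \<sigma> a = a} = {\<sigma>. \<sigma> permutes {Suc a..<N}}"
proof (intro Collect_cong iffI)
  fix \<sigma> assume s: "\<sigma> permutes {a..<N} \<and> \<sigma> a = a"
  have "x \<in> {Suc a..<N}" if "x \<in> {a..<N}" "\<sigma> x \<noteq> x" for x
    using that s by (cases "x = a") simp_all
  then show "\<sigma> permutes {Suc a..<N}"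
    using s permutes_superset[of \<sigma> "{a..<N}" "{Suc a..<N}"] by force
next
  fix \<sigma> assume s: "\<sigma> permutes {Suc a..<N}"
  then have "\<sigma> permutes {a..<N}" by (rule permutes_subset) simp
  moreover have "\<sigma> a = a" by (rule permutes_not_in[OF s]) simp
  ultimately show "\<sigma> permutes {a..<N} \<and> \<sigma> a = a" ..
qed

text \<open>
  The coefficient of the entry \<open>A 0 j\<close> in the expansion of the Pfaffian sum along its first row.
\<close>

definition pfaffian_cofactor :: "nat \<Rightarrow> (nat \<Rightarrow> nat \<Rightarrow> 'a) \<Rightarrow> nat \<Rightarrow> 'a::comm_ring_1" where
  "pfaffian_cofactor N A j = of_nat N *
     (\<Sum>\<sigma> | \<sigma> permutes {1..<N} \<and> \<sigma> 1 = j.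
        of_int (sign \<sigma>) * (\<Prod>k\<in>{1..<N div 2}. A (\<sigma> (2 * k)) (\<sigma> (2 * k + 1))))"

text \<open>
  Each of the \<open>N\<close> positions at which a permutation takes the value \<open>0\<close> contributes the same amount,
  because block swaps and swaps inside a block move that position to the front.
\<close>

lemma pfaffian_sum_first_fixed:
  assumes "even N" "N > 0" and skew: "\<And>i j. A i j = - A j i"
  shows "pfaffian_sum N A = of_nat N * (\<Sum>\<sigma> | \<sigma> permutes {1..<N}. pf_term N A \<sigma>)"
proof -
  let ?P = "{\<sigma>. \<sigma> permutes {..<N}}"
  let ?W = "pf_term N A"
  have fin: "finite ?P" by (simp add: finite_permutations)
  have "pfaffian_sum N A = (\<Sum>\<sigma>\<in>?P. \<Sum>p<N. if \<sigma> p = 0 then ?W \<sigma> else 0)"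
    unfolding pfaffian_sum_def
  proof (intro sum.cong refl)
    fix \<sigma> assume "\<sigma> \<in> ?P"
    then have s: "\<sigma> permutes {..<N}" by simp
    obtain q where "\<sigma> q = 0" using permutes_surj[OF s] unfolding surj_def by metis
    moreover from this have "q < N"
      using permutes_in_image[OF s, of q] assms(2) by simp
    moreover from calculation(1) have "\<sigma> p = 0 \<longleftrightarrow> p = q" for p
      using permutes_inj[OF s] by (metis injD)
    ultimately show "?W \<sigma> = (\<Sum>p<N. if \<sigma> p = 0 then ?W \<sigma> else 0)"
      by simp
  qed
  also have "\<dots> = (\<Sum>p<N. \<Sum>\<sigma>\<in>?P. if \<sigma> p = 0 then ?W \<sigma> else 0)"
    by (rule sum.swap)
  also have "\<dots> = (\<Sum>p<N. \<Sum>\<sigma>\<in>?P. if \<sigma> 0 = 0 then ?W \<sigma> else 0)"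
  proof (rule sum.cong[OF refl])
    fix p assume "p \<in> {..<N}"
    define k where "k = p div 2"
    have k: "2 * k + 1 < N" using \<open>p \<in> {..<N}\<close> assms(1) unfolding k_def by auto presburger
    let ?\<rho> = "transpose 0 (2 * k) \<circ> transpose 1 (2 * k + 1) :: nat \<Rightarrow> nat"
    have rp: "?\<rho> permutes {..<N}"
      using k by (intro permutes_compose permutes_swap_id) auto
    have tp: "transpose 0 1 permutes {..<N}"
      using k by (intro permutes_swap_id) auto
    \<comment> \<open>A permutation of the positions that moves \<open>p\<close> to the front and preserves the terms.\<close>
    obtain \<tau> where t: "\<tau> permutes {..<N}" "\<tau> p = 0" "\<And>\<sigma>. \<sigma> \<in> ?P \<Longrightarrow> ?W (\<sigma> \<circ> \<tau>) = ?W \<sigma>"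
    proof (cases "even p")
      case True
      then have "p = 2 * k" by (simp add: k_def)
      then have "?\<rho> p = 0" by (simp add: transpose_def)
      with rp show ?thesis
        using pf_term_swap_blocks[OF _ k, of _ A] by (intro that[of ?\<rho>]) auto
    next
      case False
      then have "p = 2 * k + 1" by (simp add: k_def)
      then have "(transpose 0 1 \<circ> ?\<rho>) p = 0" by (simp add: transpose_def)
      moreover have "?W (\<sigma> \<circ> (transpose 0 1 \<circ> ?\<rho>)) = ?W \<sigma>" if "\<sigma> \<in> ?P" for \<sigma>
      proof -
        have s: "\<sigma> permutes {..<N}" using that by simp
        have "\<sigma> \<circ> transpose 0 1 permutes {..<N}" using s tp by (intro permutes_compose)
        from pf_term_swap_blocks[OF this k, of A] show ?thesis
          using pf_term_swap_in_block[of \<sigma> N A, OF s _ skew] k by (simp only: o_assoc)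
      qed
      ultimately show ?thesis
        using permutes_compose[OF rp tp] by (intro that[of "transpose 0 1 \<circ> ?\<rho>"])
    qed
    have "(\<Sum>\<sigma>\<in>?P. if \<sigma> 0 = 0 then ?W \<sigma> else 0) = (\<Sum>\<sigma>\<in>?P. if (\<sigma> \<circ> \<tau>) p = 0 then ?W (\<sigma> \<circ> \<tau>) else 0)"
      using t by (intro sum.cong) auto
    also have "\<dots> = (\<Sum>\<sigma>\<in>?P. if \<sigma> p = 0 then ?W \<sigma> else 0)"
      using sum_permutations_compose_right[OF t(1), of "\<lambda>\<sigma>. if \<sigma> p = 0 then ?W \<sigma> else 0"] by simp
    finally show "(\<Sum>\<sigma>\<in>?P. if \<sigma> p = 0 then ?W \<sigma> else 0) = (\<Sum>\<sigma>\<in>?P. if \<sigma> 0 = 0 then ?W \<sigma> else 0)" ..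
  qed
  also have "\<dots> = of_nat N * (\<Sum>\<sigma>\<in>{\<sigma>\<in>?P. \<sigma> 0 = 0}. ?W \<sigma>)"
    unfolding sum.inter_filter[OF fin] by simp
  also have "{\<sigma>\<in>?P. \<sigma> 0 = 0} = {\<sigma>. \<sigma> permutes {1..<N}}"
    using permutes_fixing_first[of 0 N] by (simp add: lessThan_atLeast0)
  finally show ?thesis .
qed

lemma pfaffian_sum_expand_first:
  assumes "even N" "N > 0" and skew: "\<And>i j. A i j = - A j i"
  shows "pfaffian_sum N A = (\<Sum>j\<in>{1..<N}. A 0 j * pfaffian_cofactor N A j)"
proof -
  let ?P = "{\<sigma>. \<sigma> permutes {1..<N}}"
  let ?V = "\<lambda>\<sigma>. of_int (sign \<sigma>) * (\<Prod>k\<in>{1..<N div 2}. A (\<sigma> (2 * k)) (\<sigma> (2 * k + 1)))"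
  have fin: "finite ?P" by (simp add: finite_permutations)
  have N: "N \<ge> 2" "1 \<in> {1..<N}" using assms by auto
  have "(\<Sum>\<sigma>\<in>?P. pf_term N A \<sigma>) = (\<Sum>\<sigma>\<in>?P. A 0 (\<sigma> 1) * ?V \<sigma>)"
  proof (intro sum.cong refl)
    fix \<sigma> assume "\<sigma> \<in> ?P"
    then have "\<sigma> 0 = 0" by (auto simp: permutes_def)
    moreover have "{..<N div 2} = insert 0 {1..<N div 2}" using N by auto
    ultimately show "pf_term N A \<sigma> = A 0 (\<sigma> 1) * ?V \<sigma>" by (simp add: mult_ac)
  qed
  also have "\<dots> = (\<Sum>\<sigma>\<in>?P. \<Sum>j\<in>{1..<N}. if \<sigma> 1 = j then A 0 j * ?V \<sigma> else 0)"
  proof (intro sum.cong refl)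
    fix \<sigma> assume "\<sigma> \<in> ?P"
    then have "\<sigma> 1 \<in> {1..<N}" using permutes_in_image[of \<sigma> "{1..<N}" 1] N by simp
    then show "A 0 (\<sigma> 1) * ?V \<sigma> = (\<Sum>j\<in>{1..<N}. if \<sigma> 1 = j then A 0 j * ?V \<sigma> else 0)"
      by simp
  qed
  also have "\<dots> = (\<Sum>j\<in>{1..<N}. \<Sum>\<sigma>\<in>?P. if \<sigma> 1 = j then A 0 j * ?V \<sigma> else 0)"
    by (rule sum.swap)
  also have "\<dots> = (\<Sum>j\<in>{1..<N}. A 0 j * (\<Sum>\<sigma>\<in>{\<sigma>\<in>?P. \<sigma> 1 = j}. ?V \<sigma>))"
    unfolding sum_distrib_left sum.inter_filter[OF fin] by (intro sum.cong refl) simp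
  finally show ?thesis
    unfolding pfaffian_sum_first_fixed[OF assms] pfaffian_cofactor_def
    by (simp add: sum_distrib_left mult.left_commute)
qed

lemma pfaffian_cofactor_cong:
  assumes "even N" "\<And>i j. i \<in> {1..<N} \<Longrightarrow> j \<in> {1..<N} \<Longrightarrow> A i j = B i j"
  shows "pfaffian_cofactor N A l = pfaffian_cofactor N B l"
  unfolding pfaffian_cofactor_def
proof (intro sum.cong refl arg_cong2[of _ _ _ _ "(*)"] prod.cong)
  fix \<sigma> k assume s: "\<sigma> \<in> {\<sigma>. \<sigma> permutes {1..<N} \<and> \<sigma> 1 = l}" and k: "k \<in> {1..<N div 2}"
  have "2 * k \<in> {1..<N}" "2 * k + 1 \<in> {1..<N}" using k assms(1) by auto
  then have "\<sigma> (2 * k) \<in> {1..<N}" "\<sigma> (2 * k + 1) \<in> {1..<N}"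
    using s permutes_in_image[of \<sigma> "{1..<N}"] by blast+
  then show "A (\<sigma> (2 * k)) (\<sigma> (2 * k + 1)) = B (\<sigma> (2 * k)) (\<sigma> (2 * k + 1))"
    by (rule assms)
qed

lemma sum_permutes_shift:
  fixes G :: "(nat \<Rightarrow> nat) \<Rightarrow> 'a::comm_ring_1"
  assumes "\<And>f g. (\<And>i. i < N \<Longrightarrow> f i = g i) \<Longrightarrow> G f = G g"
  shows "(\<Sum>\<sigma> | \<sigma> permutes {s..<s + N}. of_int (sign \<sigma>) * G (\<lambda>i. \<sigma> (i + s))) =
         (\<Sum>\<sigma> | \<sigma> permutes {..<N}. of_int (sign \<sigma>) * G (\<lambda>i. \<sigma> i + s))"
proof -
  let ?f = "\<lambda>i. i + s" and ?A = "{..<N}" and ?B = "{s..<s + N}"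
  have bij: "bij_betw ?f ?A ?B"
    by (rule bij_betwI[of _ _ _ "\<lambda>i. i - s"]) auto
  have bij': "bij_betw (\<lambda>i. i - s) ?B ?A"
    by (rule bij_betwI[of _ _ _ ?f]) auto
  have inj: "inj_on ?f ?A" by auto
  show ?thesis
  proof (rule sum.reindex_bij_witness[where i = "map_permutation ?A ?f" and j = "map_permutation ?B (\<lambda>i. i - s)", symmetric, symmetric])
    fix \<sigma> assume "\<sigma> \<in> {\<sigma>. \<sigma> permutes ?B}"
    then have s: "\<sigma> permutes ?B" by simp
    show "map_permutation ?A ?f (map_permutation ?B (\<lambda>i. i - s) \<sigma>) = \<sigma>"
      by (rule map_permutation_compose_inv[OF bij' s]) auto
    show p: "map_permutation ?B (\<lambda>i. i - s) \<sigma> \<in> {\<sigma>. \<sigma> permutes ?A}"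
      using map_permutation_permutes[OF bij' s] by simp
    have "map_permutation ?B (\<lambda>i. i - s) \<sigma> i + s = \<sigma> (i + s)" if "i < N" for i
    proof -
      have "map_permutation ?B (\<lambda>i. i - s) \<sigma> (i + s - s) = \<sigma> (i + s) - s"
        by (rule map_permutation_apply) (use that in \<open>auto simp: inj_on_def\<close>)
      moreover have "\<sigma> (i + s) \<in> ?B"
        using permutes_in_image[OF s, of "i + s"] that by simp
      ultimately show ?thesis by simp
    qed
    then have "G (\<lambda>i. map_permutation ?B (\<lambda>i. i - s) \<sigma> i + s) = G (\<lambda>i. \<sigma> (i + s))"
      by (intro assms)
    moreover have "sign (map_permutation ?B (\<lambda>i. i - s) \<sigma>) = sign \<sigma>"
      by (rule sign_map_permutation[OF _ s]) (auto simp: inj_on_def)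
    ultimately show "of_int (sign (map_permutation ?B (\<lambda>i. i - s) \<sigma>)) * G (\<lambda>i. map_permutation ?B (\<lambda>i. i - s) \<sigma> i + s) =
        of_int (sign \<sigma>) * G (\<lambda>i. \<sigma> (i + s))"
      by simp
  next
    fix \<sigma> assume "\<sigma> \<in> {\<sigma>. \<sigma> permutes ?A}"
    then have s: "\<sigma> permutes ?A" by simp
    show "map_permutation ?B (\<lambda>i. i - s) (map_permutation ?A ?f \<sigma>) = \<sigma>"
      by (rule map_permutation_compose_inv[OF bij s]) auto
    show "map_permutation ?A ?f \<sigma> \<in> {\<sigma>. \<sigma> permutes ?B}"
      using map_permutation_permutes[OF bij s] by simp
  qed
qed

text \<open>
  If the indices \<open>0\<close> and \<open>1\<close> are paired, then the others are permuted arbitrarily.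
\<close>

lemma pfaffian_cofactor_1:
  assumes "even N" "N > 0"
  shows "pfaffian_cofactor N A 1 = of_nat N * pfaffian_sum (N - 2) (\<lambda>i j. A (i + 2) (j + 2))"
proof -
  let ?G = "\<lambda>f. \<Prod>k<(N - 2) div 2. A (f (2 * k)) (f (2 * k + 1))"
  have N: "{2..<N} = {2..<2 + (N - 2)}" using assms by auto
  have "{\<sigma>. \<sigma> permutes {1..<N} \<and> \<sigma> 1 = 1} = {\<sigma>. \<sigma> permutes {2..<N}}"
    using permutes_fixing_first[of 1 N] by (simp add: numeral_2_eq_2)
  moreover have "(\<Prod>k\<in>{1..<N div 2}. A (\<sigma> (2 * k)) (\<sigma> (2 * k + 1))) = ?G (\<lambda>i. \<sigma> (i + 2))" for \<sigma> :: "nat \<Rightarrow> nat"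
  proof (rule prod.reindex_bij_witness[of _ Suc "\<lambda>k. k - 1"])
    fix k assume "k \<in> {1..<N div 2}"
    then show "A (\<sigma> (2 * (k - 1) + 2)) (\<sigma> (2 * (k - 1) + 1 + 2)) = A (\<sigma> (2 * k)) (\<sigma> (2 * k + 1))"
      by (cases k) simp_all
  qed (use assms in auto)
  moreover have "(\<Sum>\<sigma> | \<sigma> permutes {2..<2 + (N - 2)}. of_int (sign \<sigma>) * ?G (\<lambda>i. \<sigma> (i + 2))) =
     (\<Sum>\<sigma> | \<sigma> permutes {..<N - 2}. of_int (sign \<sigma>) * ?G (\<lambda>i. \<sigma> i + 2))"
    by (rule sum_permutes_shift) (auto intro!: prod.cong)
  ultimately show ?thesis
    unfolding pfaffian_cofactor_def pfaffian_sum_def N[symmetric] by simp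
qed

text \<open>
  Indexing by a list of labels instead of numbers turns exchanges of rows and columns into exchanges
  of neighbours in the list.
\<close>

definition pf_list :: "('b \<Rightarrow> 'b \<Rightarrow> 'a::comm_ring_1) \<Rightarrow> 'b list \<Rightarrow> 'a" where
  "pf_list F L = pfaffian_sum (length L) (\<lambda>i j. F (L ! i) (L ! j))"

text \<open>
  The cofactors of the row of a label in front of \<open>r\<close>.  That label has the index \<open>0\<close>, so the entries of
  \<open>r\<close> appear with indices shifted by one.
\<close>

definition list_cofactor :: "('b \<Rightarrow> 'b \<Rightarrow> 'a::comm_ring_1) \<Rightarrow> 'b list \<Rightarrow> nat \<Rightarrow> 'a" where
  "list_cofactor F r j = pfaffian_cofactor (Suc (length r)) (\<lambda>i k. F (r ! (i - 1)) (r ! (k - 1))) (Suc j)"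

lemma pf_list_swap: "pf_list F (p @ a # b # r) = - pf_list F (p @ b # a # r)"
proof -
  let ?L = "p @ a # b # r" and ?L' = "p @ b # a # r"
  let ?t = "transpose (length p) (Suc (length p))"
  have t: "?t permutes {..<length ?L}" by (rule permutes_swap_id) auto
  have "?L' ! i = ?L ! ?t i" for i
    by (auto simp: transpose_def nth_append nth_Cons' Suc_diff_le)
  then have "pf_list F ?L' = pfaffian_sum (length ?L) (\<lambda>i j. F (?L ! ?t i) (?L ! ?t j))"
    by (simp add: pf_list_def)
  also have "\<dots> = - pf_list F ?L"
    using pfaffian_sum_permute[OF t, of "\<lambda>i j. F (?L ! i) (?L ! j)"]
    by (simp add: pf_list_def sign_swap_id)
  finally show ?thesis by simp
qed

lemma pf_list_expand:
  assumes "odd (length r)" and skew: "\<And>a b. F a b = - F b a"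
  shows "pf_list F (a # r) = (\<Sum>j<length r. F a (r ! j) * list_cofactor F r j)"
proof -
  let ?A = "\<lambda>i j. F ((a # r) ! i) ((a # r) ! j)" and ?B = "\<lambda>i k. F (r ! (i - 1)) (r ! (k - 1))"
  have "pf_list F (a # r) = (\<Sum>j\<in>{1..<Suc (length r)}. ?A 0 j * pfaffian_cofactor (Suc (length r)) ?A j)"
    unfolding pf_list_def list.size using assms(1)
    by (subst pfaffian_sum_expand_first) (auto simp: skew[symmetric])
  also have "\<dots> = (\<Sum>j\<in>{1..<Suc (length r)}. ?A 0 j * pfaffian_cofactor (Suc (length r)) ?B j)"
    using assms(1) by (intro sum.cong refl arg_cong2[of _ _ _ _ "(*)"] pfaffian_cofactor_cong) auto
  also have "\<dots> = (\<Sum>j<length r. F a (r ! j) * list_cofactor F r j)"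
    unfolding list_cofactor_def
    by (rule sum.reindex_bij_witness[of _ Suc "\<lambda>j. j - 1"]) auto
  finally show ?thesis .
qed

lemma list_cofactor_cong:
  assumes "odd (length r)" "\<And>a b. a \<in> set r \<Longrightarrow> b \<in> set r \<Longrightarrow> F a b = F' a b"
  shows "list_cofactor F r j = list_cofactor F' r j"
  unfolding list_cofactor_def
  by (rule pfaffian_cofactor_cong) (use assms in auto)

lemma list_cofactor_0:
  assumes "even (length r)"
  shows "list_cofactor F (b # r) 0 = of_nat (length r + 2) * pf_list F r"
  using pfaffian_cofactor_1[of "Suc (Suc (length r))" "\<lambda>i k. F ((b # r) ! (i - 1)) ((b # r) ! (k - 1))"] assms
  by (simp add: list_cofactor_def pf_list_def)

text \<open>
  Moving equal labels next to each other gives a value that equals its own negative.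
\<close>

lemma pf_list_repeat:
  fixes F :: "'b \<Rightarrow> 'b \<Rightarrow> 'a::{idom,ring_char_0}"
  shows "pf_list F (p @ a # q @ a # r) = 0"
proof (induction q arbitrary: p)
  case Nil
  have "pf_list F (p @ a # a # r) + pf_list F (p @ a # a # r) = 0"
    by (subst (2) pf_list_swap) simp
  then have "2 * pf_list F (p @ a # a # r) = 0" by (simp only: mult_2)
  then show ?case by simp
next
  case (Cons b q)
  show ?case using pf_list_swap[of F p a b "q @ a # r"] Cons.IH[of "p @ [b]"] by simp
qed

lemma pf_list_cong:
  assumes "\<And>a b. a \<in> set L \<Longrightarrow> b \<in> set L \<Longrightarrow> F a b = F' a b"
  shows "pf_list F L = pf_list F' L"
  unfolding pf_list_def by (rule pfaffian_sum_cong) (use assms in auto)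

section \<open>The Pfaffian formula for the partition function\<close>

text \<open>
  The label \<open>Pt x\<close> is an ordinary parameter and \<open>Border\<close> the additional row of ones for an odd number
  of parameters.  The label \<open>Free\<close> is the parameter in which one interpolates; its row is
  multiplied by all denominators and thereby polynomial.
\<close>

datatype 'a point = Free | Border | Pt 'a

definition pair_num :: "'a::comm_ring_1 \<Rightarrow> 'a \<Rightarrow> 'a" where
  "pair_num x y = (y - x) * (2 + x * y)"

definition pair_den :: "'a::comm_ring_1 \<Rightarrow> 'a \<Rightarrow> 'a" where
  "pair_den x y = (1 - x * y) * (1 - x - y)"

text \<open>
  The entry \<open>pair_num X y / pair_den X y\<close> times the denominators \<open>pair_den X w\<close> for all \<open>w \<in> Y\<close>.
\<close>

definition free_entry :: "'a::comm_ring_1 \<Rightarrow> 'a set \<Rightarrow> 'a \<Rightarrow> 'a" where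
  "free_entry X Y y = pair_num X y * (\<Prod>w\<in>Y - {y}. pair_den X w)"

fun point_kernel :: "('a::comm_ring_1 \<Rightarrow> 'a \<Rightarrow> 'a) \<Rightarrow> 'a \<Rightarrow> 'a set \<Rightarrow> 'a point \<Rightarrow> 'a point \<Rightarrow> 'a" where
  "point_kernel f X Y (Pt x) (Pt y) = f x y"
| "point_kernel f X Y Border (Pt y) = 1"
| "point_kernel f X Y (Pt x) Border = - 1"
| "point_kernel f X Y Free (Pt y) = free_entry X Y y"
| "point_kernel f X Y (Pt x) Free = - free_entry X Y x"
| "point_kernel f X Y Free Border = - (\<Prod>w\<in>Y. pair_den X w)"
| "point_kernel f X Y Border Free = (\<Prod>w\<in>Y. pair_den X w)"
| "point_kernel f X Y _ _ = 0"

lemma point_kernel_skew: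
  assumes f: "\<And>x y. f x y = - f y x"
  shows "point_kernel f X Y a b = - point_kernel f X Y b a"
  by (cases a; cases b) (auto intro: f)

definition border :: "nat \<Rightarrow> 'a point list" where
  "border n = (if odd n then [Border] else [])"

text \<open>
  The sign that arises when the label after the border moves to the front.
\<close>

definition border_sign :: "nat \<Rightarrow> 'a::comm_ring_1" where
  "border_sign n = (if odd n then - 1 else 1)"

definition other_points :: "'a list \<Rightarrow> 'a point list" where
  "other_points ys = border (Suc (length ys)) @ map Pt ys"

lemma odd_length_other_points: "odd (length (other_points ys))"
  by (simp add: other_points_def border_def)

lemma pf_list_other_points:
  assumes "\<And>a b. F a b = - F b a"
  shows "pf_list F (border (Suc (length ys)) @ a # map Pt ys) =
    border_sign (Suc (length ys)) * (\<Sum>j<length (other_points ys). F a (other_points ys ! j) * list_cofactor F (other_points ys) j)"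
proof -
  have "pf_list F (border (Suc (length ys)) @ a # map Pt ys) =
    border_sign (Suc (length ys)) * pf_list F (a # other_points ys)"
    using pf_list_swap[of F "[]" Border a "map Pt ys"] by (simp add: border_def border_sign_def other_points_def)
  then show ?thesis
    using pf_list_expand[of "other_points ys" F, OF odd_length_other_points assms] by simp
qed

fun vandermonde_prod :: "'a::comm_ring_1 list \<Rightarrow> 'a" where
  "vandermonde_prod [] = 1"
| "vandermonde_prod (x # xs) = (\<Prod>y\<leftarrow>xs. y - x) * vandermonde_prod xs"

fun den_prod :: "'a::comm_ring_1 list \<Rightarrow> 'a" where
  "den_prod [] = 1"
| "den_prod (x # xs) = (\<Prod>y\<leftarrow>xs. pair_den x y) * den_prod xs"

lemma vandermonde_prod_swap: "vandermonde_prod (p @ x # y # r) = - vandermonde_prod (p @ y # x # r)"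
  by (induction p) (simp_all add: algebra_simps)

lemma den_prod_swap: "den_prod (p @ x # y # r) = den_prod (p @ y # x # r)"
  by (induction p) (simp_all add: algebra_simps pair_den_def)

text \<open>
  The normalising factor \<open>2\<^sup>m m!\<close> of the Pfaffian of size \<open>2 m\<close>, where \<open>2 m\<close> is \<open>n\<close> or \<open>n + 1\<close>.
\<close>

definition pairings :: "nat \<Rightarrow> nat" where
  "pairings n = 2 ^ ((n + 1) div 2) * fact ((n + 1) div 2)"

abbreviation base_kernel :: "('a::comm_ring_1 \<Rightarrow> 'a \<Rightarrow> 'a) \<Rightarrow> 'a point \<Rightarrow> 'a point \<Rightarrow> 'a" where
  "base_kernel f \<equiv> point_kernel f 0 {}"

definition pf_points :: "('a::comm_ring_1 \<Rightarrow> 'a \<Rightarrow> 'a) \<Rightarrow> 'a list \<Rightarrow> 'a" where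
  "pf_points f xs = pf_list (base_kernel f) (border (length xs) @ map Pt xs)"

definition pf_free :: "('a::comm_ring_1 \<Rightarrow> 'a \<Rightarrow> 'a) \<Rightarrow> 'a \<Rightarrow> 'a list \<Rightarrow> 'a" where
  "pf_free f X ys = pf_list (point_kernel f X (set ys)) (border (Suc (length ys)) @ Free # map Pt ys)"

lemma pf_free_expand:
  assumes "\<And>x y. f x y = - f y x"
  shows "pf_free f X ys =
    border_sign (Suc (length ys)) * (\<Sum>j<length (other_points ys). point_kernel f X (set ys) Free (other_points ys ! j) * list_cofactor (base_kernel f) (other_points ys) j)"
proof -
  have "list_cofactor (point_kernel f X (set ys)) (other_points ys) j = list_cofactor (base_kernel f) (other_points ys) j" for j
  proof (rule list_cofactor_cong)
    fix a b assume "a \<in> set (other_points ys)" "b \<in> set (other_points ys)"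
    then have "a \<noteq> Free" "b \<noteq> Free" by (auto simp: other_points_def border_def split: if_splits)
    then show "point_kernel f X (set ys) a b = base_kernel f a b" by (cases a; cases b) simp_all
  qed (rule odd_length_other_points)
  then show ?thesis
    unfolding pf_free_def pf_list_other_points[of "point_kernel f X (set ys)", OF point_kernel_skew[OF assms]] by simp
qed

text \<open>
  At special values the polynomial row of the free parameter is a multiple of an ordinary row.
\<close>

lemma pf_free_row_multiple:
  assumes "\<And>x y. f x y = - f y x"
    and "\<And>l. l \<in> set (other_points ys) \<Longrightarrow> point_kernel f X (set ys) Free l = c * base_kernel f a l"
  shows "pf_free f X ys = c * pf_list (base_kernel f) (border (Suc (length ys)) @ a # map Pt ys)"
  unfolding pf_free_expand[OF assms(1)] pf_list_other_points[of "base_kernel f", OF point_kernel_skew[OF assms(1)]]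
  by (simp add: assms(2) sum_distrib_left mult_ac)

lemma prod_list_distinct: "distinct ys \<Longrightarrow> (\<Prod>y\<leftarrow>ys. g y) = (\<Prod>y\<in>set ys. g y)"
  for g :: "'b \<Rightarrow> 'a::comm_monoid_mult"
  by (induction ys) simp_all

text \<open>
  The Pfaffian formula for the parameters \<open>X # ys\<close>, in the polynomial form that allows arbitrary \<open>X\<close>.
\<close>

definition interpolation_identity :: "('a::comm_ring_1 \<Rightarrow> 'a \<Rightarrow> 'a) \<Rightarrow> 'a list \<Rightarrow> 'a \<Rightarrow> bool" where
  "interpolation_identity f ys X \<longleftrightarrow>
     of_nat (pairings (Suc (length ys))) * partition_fn (X # ys) * (\<Prod>y\<leftarrow>ys. y - X) * vandermonde_prod ys =
     den_prod ys * pf_free f X ys"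

definition pfaffian_identity :: "('a::comm_ring_1 \<Rightarrow> 'a \<Rightarrow> 'a) \<Rightarrow> 'a list \<Rightarrow> bool" where
  "pfaffian_identity f xs \<longleftrightarrow>
     of_nat (pairings (length xs)) * partition_fn xs * vandermonde_prod xs = den_prod xs * pf_points f xs"

lemma poly_bounded_free_entry:
  assumes "l \<in> set (other_points ys)"
  shows "poly_bounded (2 * length ys) (\<lambda>X. point_kernel f X (set ys) Free l)"
proof -
  have lin: "poly_bounded 1 (\<lambda>X. a + b * X)" for a b :: 'a by (rule poly_bounded_linear) simp
  have quad: "poly_bounded 2 (\<lambda>X. (a + b * X) * (c + d * X))" for a b c d :: 'a
    using poly_bounded_mult[OF lin lin] by (simp add: numeral_2_eq_2)
  have "(\<lambda>X. pair_den X w) = (\<lambda>X. (1 + (- w) * X) * ((1 - w) + (- 1) * X))"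
    "(\<lambda>X. pair_num X w) = (\<lambda>X. (w + (- 1) * X) * (2 + w * X))" for w :: 'a
    by (simp_all add: pair_den_def pair_num_def fun_eq_iff algebra_simps)
  then have den: "poly_bounded 2 (\<lambda>X. pair_den X w)" and num: "poly_bounded 2 (\<lambda>X. pair_num X w)" for w :: 'a
    by (simp_all only: quad)
  have prod: "poly_bounded (2 * card Y) (\<lambda>X. \<Prod>w\<in>Y. pair_den X w)" if "finite Y" for Y :: "'a set"
    by (rule poly_bounded_prod[OF that den])
  show ?thesis
  proof (cases l)
    case (Pt y)
    then have y: "y \<in> set ys" using assms by (auto simp: other_points_def border_def split: if_splits)
    then have "card (set ys - {y}) + 1 \<le> length ys"
      using card_length[of ys] card_Suc_Diff1[OF finite_set y] by simp
    then have "poly_bounded (2 * length ys) (\<lambda>X. free_entry X (set ys) y)"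
      unfolding free_entry_def
      by (intro poly_bounded_mono[OF poly_bounded_mult[OF num prod]]) simp_all
    then show ?thesis using Pt by simp
  next
    case Border
    have "poly_bounded (0 + 2 * card (set ys)) (\<lambda>X. (- 1) * (\<Prod>w\<in>set ys. pair_den X w))"
      by (intro poly_bounded_mult prod poly_bounded_const) simp
    then show ?thesis using Border card_length[of ys] by (auto intro: poly_bounded_mono)
  next
    case Free
    then show ?thesis using assms by (auto simp: other_points_def border_def split: if_splits)
  qed
qed

text \<open>
  The parameters are taken from a set on which the interpolation nodes are distinct and the scalars
  in the exchange relation can be cancelled.  The entries \<open>f x y\<close> are quotients, expressed by an
  equation that makes sense in every integral domain.
\<close>

locale generic_points =
  fixes G :: "'a::{idom,ring_char_0} set" and f :: "'a \<Rightarrow> 'a \<Rightarrow> 'a"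
  assumes entry: "x \<in> G \<Longrightarrow> y \<in> G \<Longrightarrow> f x y * pair_den x y = pair_num x y"
    and skew: "f x y = - f y x"
    and reflect: "x \<in> G \<Longrightarrow> 1 - x \<notin> G"
    and minus_one: "- 1 \<notin> G" and two: "2 \<notin> G"
    and exchange: "x \<in> G \<Longrightarrow> y \<in> G \<Longrightarrow> 1 - y + x * y \<noteq> 0"
begin

text \<open>
  For an admissible value of the free parameter its row is the ordinary row times the denominators.
\<close>

lemma pf_free_at_point:
  assumes "x \<in> G" "set ys \<subseteq> G"
  shows "pf_free f x ys = (\<Prod>w\<in>set ys. pair_den x w) *
    pf_list (base_kernel f) (border (Suc (length ys)) @ Pt x # map Pt ys)"
proof (rule pf_free_row_multiple)
  show "f x y = - f y x" for x y by (rule skew)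
  fix l assume l: "l \<in> set (other_points ys)"
  show "point_kernel f x (set ys) Free l = (\<Prod>w\<in>set ys. pair_den x w) * base_kernel f (Pt x) l"
  proof (cases l)
    case (Pt y)
    then have y: "y \<in> set ys" using l by (auto simp: other_points_def border_def split: if_splits)
    then have "y \<in> G" using assms by auto
    then show ?thesis
      using Pt y entry[OF assms(1) \<open>y \<in> G\<close>]
      by (simp add: free_entry_def prod.remove[OF _ y] mult_ac)
  qed (use l in \<open>auto simp: other_points_def border_def split: if_splits\<close>)
qed

lemma interpolation_identity_swap:
  assumes "x \<in> G" "y \<in> G"
  shows "interpolation_identity f (p @ x # y # r) X \<longleftrightarrow> interpolation_identity f (p @ y # x # r) X"
proof -
  have 1: "partition_fn (X # p @ x # y # r) = partition_fn (X # p @ y # x # r)"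
    using partition_fn_swap[OF exchange[OF assms], of "X # p" r] by simp
  have 2: "pf_free f X (p @ x # y # r) = - pf_free f X (p @ y # x # r)"
    using pf_list_swap[of "point_kernel f X (set (p @ x # y # r))"
        "border (Suc (length (p @ x # y # r))) @ Free # map Pt p" "Pt x" "Pt y" "map Pt r"]
    by (simp add: pf_free_def insert_commute)
  have 3: "(\<Prod>w\<leftarrow>p @ x # y # r. w - X) = (\<Prod>w\<leftarrow>p @ y # x # r. w - X)"
    by (simp add: mult_ac)
  show ?thesis
    unfolding interpolation_identity_def 1 2 3 vandermonde_prod_swap[of p x y r] den_prod_swap[of p x y r]
    by simp
qed

lemma interpolation_identity_to_front:
  assumes "set (p @ z # r) \<subseteq> G" "interpolation_identity f (z # p @ r) X"
  shows "interpolation_identity f (p @ z # r) X"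
  using assms
proof (induction p arbitrary: r rule: rev_induct)
  case (snoc a p)
  then have "interpolation_identity f (p @ z # a # r) X" by auto
  then show ?case using snoc.prems interpolation_identity_swap[of z a p r X] by simp
qed simp

text \<open>
  Both sides vanish: the left one by the factor \<open>y - X\<close>, the right one by two equal rows.
\<close>

lemma interpolation_identity_at_node:
  assumes "set ys \<subseteq> G" "x \<in> set ys"
  shows "interpolation_identity f ys x"
proof -
  obtain p r where ys: "ys = p @ x # r" using assms(2) split_list by metis
  have "pf_list (base_kernel f) (border (Suc (length ys)) @ Pt x # map Pt ys) = 0"
    using pf_list_repeat[of "base_kernel f" "border (Suc (length ys))" "Pt x" "map Pt p" "map Pt r"]
    by (simp add: ys)
  then have "pf_free f x ys = 0"
    using pf_free_at_point[of x ys] assms by auto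
  moreover have "(\<Prod>y\<leftarrow>ys. y - x) = 0" by (simp add: ys)
  ultimately show ?thesis by (simp add: interpolation_identity_def)
qed

text \<open>
  At \<open>X = -1\<close> the quotient \<open>f (X, y)\<close> is \<open>1\<close>, so the free row becomes a row of ones.  For even \<open>n\<close>
  this is the border of the formula for \<open>n - 1\<close> parameters.  For odd \<open>n\<close> the free row and the border
  agree except for their mutual entry, so only the terms that pair them survive.
\<close>

lemma pf_free_minus_one:
  assumes "distinct ys"
  shows "of_nat (pairings (length ys)) * pf_free f (- 1) ys =
    of_nat (pairings (Suc (length ys))) * (\<Prod>y\<leftarrow>ys. (1 + y) * (2 - y)) * pf_points f ys"
proof -
  define c where "c = (\<Prod>y\<in>set ys. (1 + y) * (2 - y))"
  have den: "pair_den (- 1) y = (1 + y) * (2 - y)" and num: "pair_num (- 1) y = (1 + y) * (2 - y)" for y :: 'a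
    by (simp_all add: pair_den_def pair_num_def algebra_simps)
  have Pt: "point_kernel f (- 1) (set ys) Free (Pt y) = c" if "y \<in> set ys" for y
    using that by (simp add: free_entry_def den num c_def prod.remove[OF _ that])
  have Bd: "point_kernel f (- 1) (set ys) Free Border = - c"
    by (simp add: den c_def)
  have c: "c = (\<Prod>y\<leftarrow>ys. (1 + y) * (2 - y))"
    using assms by (simp add: c_def prod_list_distinct)
  show ?thesis
  proof (cases "even (length ys)")
    case False
    have "pf_free f (- 1) ys = c * pf_list (base_kernel f) (border (Suc (length ys)) @ Border # map Pt ys)"
      by (rule pf_free_row_multiple[OF skew]) (use False Pt in \<open>auto simp: other_points_def border_def\<close>)
    moreover have "pairings (Suc (length ys)) = pairings (length ys)"
      using False by (auto simp: pairings_def elim!: oddE)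
    ultimately show ?thesis
      using False by (simp add: c pf_points_def border_def)
  next
    case True
    let ?K = "base_kernel f"
    let ?c = "\<lambda>j. list_cofactor ?K (other_points ys) j"
    have r: "other_points ys = Border # map Pt ys" using True by (simp add: other_points_def border_def)
    have c0: "?c 0 = of_nat (length ys + 2) * pf_points f ys"
      using list_cofactor_0[of "map Pt ys" ?K Border] True by (simp add: r pf_points_def border_def)
    have "0 = pf_list ?K (Border # other_points ys)"
      using pf_list_repeat[of ?K "[]" Border "[]" "map Pt ys"] by (simp add: r)
    also have "\<dots> = (\<Sum>j<length (other_points ys). ?K Border (other_points ys ! j) * ?c j)"
      by (rule pf_list_expand[OF odd_length_other_points point_kernel_skew[OF skew]])
    also have "\<dots> = (\<Sum>j<length ys. ?c (Suc j))"
      unfolding r by (simp add: sum.lessThan_Suc_shift del: sum.lessThan_Suc)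
    finally have zero: "(\<Sum>j<length ys. ?c (Suc j)) = 0" ..
    have "pf_free f (- 1) ys = - (\<Sum>j<length (other_points ys). point_kernel f (- 1) (set ys) Free (other_points ys ! j) * ?c j)"
      using True by (simp add: pf_free_expand[OF skew] border_sign_def)
    also have "(\<Sum>j<length (other_points ys). point_kernel f (- 1) (set ys) Free (other_points ys ! j) * ?c j)
        = - c * ?c 0 + (\<Sum>j<length ys. c * ?c (Suc j))"
      using Pt Bd unfolding r by (simp add: sum.lessThan_Suc_shift del: sum.lessThan_Suc point_kernel.simps)
    also have "\<dots> = - (c * ?c 0)"
      unfolding sum_distrib_left[symmetric] zero by simp
    finally have "pf_free f (- 1) ys = c * of_nat (length ys + 2) * pf_points f ys"
      by (simp add: c0)
    moreover have "pairings (Suc (length ys)) = (length ys + 2) * pairings (length ys)"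
      using True by (auto simp: pairings_def algebra_simps elim!: evenE)
    ultimately show ?thesis by (simp only: c of_nat_mult mult_ac)
  qed
qed

lemma interpolation_identity_minus_one:
  assumes "distinct ys" "pfaffian_identity f ys"
  shows "interpolation_identity f ys (- 1)"
proof -
  have "of_nat (pairings (length ys)) * (den_prod ys * pf_free f (- 1) ys) =
    of_nat (pairings (length ys)) * (of_nat (pairings (Suc (length ys))) * partition_fn (- 1 # ys) * (\<Prod>y\<leftarrow>ys. y - - 1) * vandermonde_prod ys)"
  proof -
    have "of_nat (pairings (length ys)) * (den_prod ys * pf_free f (- 1) ys) =
      den_prod ys * (of_nat (pairings (length ys)) * pf_free f (- 1) ys)"
      by (simp add: mult_ac)
    also have "\<dots> = of_nat (pairings (Suc (length ys))) * (\<Prod>y\<leftarrow>ys. (1 + y) * (2 - y)) * (den_prod ys * pf_points f ys)"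
      unfolding pf_free_minus_one[OF assms(1)] by (simp add: mult_ac)
    also have "den_prod ys * pf_points f ys = of_nat (pairings (length ys)) * partition_fn ys * vandermonde_prod ys"
      using assms(2) by (simp add: pfaffian_identity_def)
    finally show ?thesis
      by (simp add: partition_fn_minus_one prod_list_mult_map mult_ac add.commute)
  qed
  moreover have "of_nat (pairings (length ys)) \<noteq> (0::'a)" by (simp add: pairings_def)
  ultimately show ?thesis by (simp add: interpolation_identity_def)
qed

text \<open>
  At \<open>X = 1 - z\<close> the denominator of the pair \<open>X, z\<close> vanishes.  All terms of the cleared Pfaffian in
  which \<open>X\<close> and \<open>z\<close> are not paired contain this factor; the remaining ones form the Pfaffian of the
  other parameters, and the value of the partition function at a frozen corner matches the rest.
\<close>

lemma interpolation_identity_corner: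
  assumes "set (z # ys) \<subseteq> G" "distinct (z # ys)" "pfaffian_identity f ys"
  shows "interpolation_identity f (z # ys) (1 - z)"
proof -
  define X where "X = 1 - z"
  have Xz: "X + z = 1" "pair_den X z = 0" by (simp_all add: X_def pair_den_def)
  have swap: "partition_fn (X # z # p @ r) = partition_fn (X # p @ z # r)" if "set (z # p) \<subseteq> G" for p r
    using that
  proof (induction p arbitrary: r rule: rev_induct)
    case (snoc a p)
    then have "partition_fn (X # p @ z # a # r) = partition_fn (X # p @ a # z # r)"
      using partition_fn_swap[OF exchange, of z a "X # p" r] by simp
    then show ?case using snoc by simp
  qed simp
  have "partition_fn (X # z # ys) = (1 + X) * (1 + z) * (\<Prod>y\<leftarrow>ys. (1 - X * y) * (1 - y * z)) * partition_fn ys"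
    using swap[of ys "[]"] partition_fn_corner[OF Xz(1), of ys] assms(1) by simp
  moreover have "pf_free f X (z # ys) * of_nat (pairings (length ys)) =
      of_nat (pairings (Suc (Suc (length ys)))) * (pair_num X z * (\<Prod>y\<leftarrow>ys. pair_den X y)) * pf_points f ys"
  proof -
    let ?K = "point_kernel f X (set (z # ys))" and ?L = "border (length ys) @ map Pt ys"
    have not_Free: "l \<noteq> Free" if "l \<in> set ?L" for l
      using that by (auto simp: border_def split: if_splits)
    \<comment> \<open>Every other entry of the free row contains the factor \<open>pair_den X z = 0\<close>.\<close>
    have zero: "?K Free l = 0" if "l \<in> set ?L" for l
    proof -
      have "(\<Prod>w\<in>Y. pair_den X w) = 0" if "z \<in> Y" "finite Y" for Y
        using that Xz(2) by (intro prod_zero) auto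
      note prod_zero = this
      show ?thesis
      proof (cases l)
        case (Pt y)
        then have "y \<noteq> z" using that assms(2) by (auto simp: border_def split: if_splits)
        then have "(\<Prod>w\<in>set (z # ys) - {y}. pair_den X w) = 0" by (intro prod_zero) auto
        then show ?thesis using Pt by (simp only: point_kernel.simps free_entry_def mult_zero_right)
      next
        case Border
        have "(\<Prod>w\<in>set (z # ys). pair_den X w) = 0" by (intro prod_zero) auto
        then show ?thesis using Border by (simp only: point_kernel.simps neg_equal_0_iff_equal)
      qed (use not_Free[OF that] in simp)
    qed
    have "pf_free f X (z # ys) = pf_list ?K (Free # Pt z # ?L)"
    proof (cases "even (length ys)")
      case False
      then show ?thesis
        using pf_list_swap[of ?K "[]" Border Free "Pt z # map Pt ys"] pf_list_swap[of ?K "[Free]" Border "Pt z" "map Pt ys"]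
        by (simp add: pf_free_def border_def)
    qed (simp add: pf_free_def border_def)
    also have "\<dots> = (\<Sum>j<length (Pt z # ?L). ?K Free ((Pt z # ?L) ! j) * list_cofactor ?K (Pt z # ?L) j)"
      by (rule pf_list_expand[OF _ point_kernel_skew[OF skew]]) (simp add: border_def)
    also have "\<dots> = ?K Free (Pt z) * list_cofactor ?K (Pt z # ?L) 0 +
        (\<Sum>j<length ?L. ?K Free (?L ! j) * list_cofactor ?K (Pt z # ?L) (Suc j))"
      unfolding list.size add_Suc_right add_0_right sum.lessThan_Suc_shift nth_Cons_0 nth_Cons_Suc ..
    also have "(\<Sum>j<length ?L. ?K Free (?L ! j) * list_cofactor ?K (Pt z # ?L) (Suc j)) = 0"
      using zero[OF nth_mem] by (intro sum.neutral) auto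
    also have "list_cofactor ?K (Pt z # ?L) 0 = of_nat (length ?L + 2) * pf_list ?K ?L"
      by (rule list_cofactor_0) (simp add: border_def)
    also have "pf_list ?K ?L = pf_points f ys"
      unfolding pf_points_def
    proof (rule pf_list_cong)
      fix a b assume "a \<in> set ?L" "b \<in> set ?L"
      then have "a \<noteq> Free" "b \<noteq> Free" using not_Free by blast+
      then show "?K a b = base_kernel f a b" by (cases a; cases b) simp_all
    qed
    also have "?K Free (Pt z) = pair_num X z * (\<Prod>y\<leftarrow>ys. pair_den X y)"
      using assms(2) by (simp add: free_entry_def prod_list_distinct)
    finally have "pf_free f X (z # ys) = pair_num X z * (\<Prod>y\<leftarrow>ys. pair_den X y) * (of_nat (length ?L + 2) * pf_points f ys)"
      by simp
    moreover have "pairings (Suc (Suc (length ys))) = (length ?L + 2) * pairings (length ys)"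
      by (cases "even (length ys)") (auto simp: pairings_def border_def algebra_simps elim!: evenE oddE)
    ultimately show ?thesis by (simp only: of_nat_mult mult_ac)
  qed
  moreover have "pair_num X z = (1 + X) * (1 + z) * (z - X)"
    by (simp add: pair_num_def X_def algebra_simps)
  moreover have "(\<Prod>y\<leftarrow>ys. (1 - X * y) * (1 - y * z)) * ((\<Prod>y\<leftarrow>ys. y - X) * (\<Prod>y\<leftarrow>ys. y - z)) =
      (\<Prod>y\<leftarrow>ys. pair_den X y) * (\<Prod>y\<leftarrow>ys. pair_den z y)"
  proof -
    have "(1 - X * y) * (1 - y * z) * ((y - X) * (y - z)) = pair_den X y * pair_den z y" for y
      by (simp add: pair_den_def X_def algebra_simps)
    then show ?thesis unfolding prod_list_mult_map[symmetric] by simp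
  qed
  moreover have "of_nat (pairings (length ys)) * partition_fn ys * vandermonde_prod ys = den_prod ys * pf_points f ys"
    using assms(3) by (simp add: pfaffian_identity_def)
  note facts = calculation this
  \<comment> \<open>Both sides are compared after multiplication by the normalising factor \<open>P\<close> of the smaller Pfaffian.\<close>
  have combine: "P * (P2 * Zx * (w * BX) * (Bz * V)) = P * (Dz * D * pX)"
    if "Zx = c * A * Z" "pX * P = P2 * (nm * DX) * Q" "nm = c * w" "A * (BX * Bz) = DX * Dz" "P * Z * V = D * Q"
    for P P2 Zx w BX Bz V Dz D pX c A Z nm DX Q :: 'a
  proof -
    have "P * (P2 * Zx * (w * BX) * (Bz * V)) = P2 * c * w * (A * (BX * Bz)) * (P * Z * V)"
      by (simp add: that(1) mult_ac)
    also have "\<dots> = Dz * D * (P2 * (nm * DX) * Q)"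
      unfolding that(3-5) by (simp only: mult_ac)
    also have "\<dots> = P * (Dz * D * pX)"
      unfolding that(2)[symmetric] by (simp only: mult_ac)
    finally show ?thesis .
  qed
  have "of_nat (pairings (length ys)) *
      (of_nat (pairings (Suc (length (z # ys)))) * partition_fn (X # z # ys) * (\<Prod>y\<leftarrow>z # ys. y - X) * vandermonde_prod (z # ys)) =
    of_nat (pairings (length ys)) * (den_prod (z # ys) * pf_free f X (z # ys))"
    unfolding list.size vandermonde_prod.simps den_prod.simps list.map prod_list.Cons add_Suc_right add_0_right
    by (rule combine) (rule facts)+
  moreover have "of_nat (pairings (length ys)) \<noteq> (0::'a)" by (simp add: pairings_def)
  ultimately show ?thesis
    unfolding interpolation_identity_def X_def[symmetric] by simp
qed

text \<open>
  Interpolation in the first parameter, by induction on the number of parameters.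
\<close>

theorem pfaffian_identity_generic:
  assumes "distinct xs" "set xs \<subseteq> G"
  shows "pfaffian_identity f xs"
  using assms
proof (induction "length xs" arbitrary: xs rule: less_induct)
  case less
  show ?case
  proof (cases xs)
    case Nil
    then show ?thesis
      by (simp add: pfaffian_identity_def pairings_def partition_fn_def pf_points_def border_def pf_list_def
          pfaffian_sum_def)
  next
    case (Cons x ys)
    \<comment> \<open>The \<open>2 * length ys + 1\<close> nodes, one more than the degree bound.\<close>
    define S where "S = insert (- 1) (set ys \<union> (\<lambda>y. 1 - y) ` set ys)"
    have ys: "distinct ys" "set ys \<subseteq> G" using less.prems Cons by auto
    have IH: "pfaffian_identity f zs" if "distinct zs" "set zs \<subseteq> G" "length zs \<le> length ys" for zs
      using less.hyps[of zs] that Cons by simp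
    have at_S: "interpolation_identity f ys X" if "X \<in> S" for X
      using that unfolding S_def
    proof (elim insertE UnE imageE)
      assume "X = - 1"
      then show ?thesis using interpolation_identity_minus_one[OF ys(1)] IH ys by simp
    next
      assume "X \<in> set ys"
      then show ?thesis using interpolation_identity_at_node ys by blast
    next
      fix z assume z: "X = 1 - z" "z \<in> set ys"
      then obtain p r where pr: "ys = p @ z # r" using split_list by metis
      have "interpolation_identity f (z # p @ r) (1 - z)"
        by (rule interpolation_identity_corner) (use ys pr IH[of "p @ r"] in auto)
      then show ?thesis using interpolation_identity_to_front[of p z r] ys pr z by simp
    qed
    have "card S = Suc (2 * length ys)"
    proof -
      have "- 1 \<notin> set ys \<union> (\<lambda>y. 1 - y) ` set ys"
      proof
        assume "- 1 \<in> set ys \<union> (\<lambda>y. 1 - y) ` set ys"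
        then obtain y where "y \<in> set ys" "y = - 1 \<or> - 1 = 1 - y" by auto
        then have "y \<in> G" "y = - 1 \<or> y = 2" using ys by (auto simp: algebra_simps eq_diff_eq)
        then show False using minus_one two by auto
      qed
      moreover have "set ys \<inter> (\<lambda>y. 1 - y) ` set ys = {}" using ys reflect by auto
      moreover have "card ((\<lambda>y. 1 - y) ` set ys) = card (set ys)"
        by (rule card_image) (auto simp: inj_on_def)
      ultimately show ?thesis
        unfolding S_def by (simp add: card_Un_disjoint distinct_card[OF ys(1)])
    qed
    have lin: "poly_bounded (1 * length ys) (\<lambda>X. \<Prod>y\<leftarrow>ys. y + (- 1) * X)"
      by (intro poly_bounded_prod_list poly_bounded_linear) simp
    have "poly_bounded (0 + length ys + 1 * length ys + 0)
        (\<lambda>X. of_nat (pairings (Suc (length ys))) * partition_fn (X # ys) * (\<Prod>y\<leftarrow>ys. y + (- 1) * X) * vandermonde_prod ys)"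
      by (intro poly_bounded_mult lin poly_bounded_const poly_bounded_partition_fn)
    then have lhs: "poly_bounded (2 * length ys)
        (\<lambda>X. of_nat (pairings (Suc (length ys))) * partition_fn (X # ys) * (\<Prod>y\<leftarrow>ys. y - X) * vandermonde_prod ys)"
      by (simp add: mult_2)
    have "poly_bounded (0 + (0 + (2 * length ys + 0))) (\<lambda>X. den_prod ys * (border_sign (Suc (length ys)) *
        (\<Sum>j<length (other_points ys). point_kernel f X (set ys) Free (other_points ys ! j) * list_cofactor (base_kernel f) (other_points ys) j)))"
      by (intro poly_bounded_mult poly_bounded_sum poly_bounded_const poly_bounded_free_entry nth_mem) simp
    then have rhs: "poly_bounded (2 * length ys) (\<lambda>X. den_prod ys * pf_free f X ys)"
      by (simp add: pf_free_expand[OF skew])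
    have "interpolation_identity f ys x"
      unfolding interpolation_identity_def
    proof (rule poly_bounded_eqI[OF lhs rhs])
      show "finite S" by (simp add: S_def)
      show "2 * length ys < card S" using \<open>card S = _\<close> by simp
    qed (use at_S in \<open>simp add: interpolation_identity_def\<close>)
    moreover have "pf_free f x ys = (\<Prod>w\<leftarrow>ys. pair_den x w) * pf_points f xs"
      using pf_free_at_point[of x ys] less.prems Cons ys
      by (simp add: pf_points_def prod_list_distinct)
    ultimately show ?thesis
      by (simp add: interpolation_identity_def pfaffian_identity_def Cons mult_ac)
  qed
qed

end

section \<open>Symmetric alternating sign matrices as configurations\<close>

text \<open>
  The entry at which a partial sum changes from \<open>s\<close> to \<open>t\<close>.
\<close>

definition step :: "bool \<Rightarrow> bool \<Rightarrow> int" where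
  "step s t = of_bool t - of_bool s"

lemma step_inj [simp]: "step s t = step s t' \<longleftrightarrow> t = t'"
  by (auto simp: step_def)

text \<open>
  A line whose partial sums, starting from \<open>s\<close>, stay in \<open>{0, 1}\<close> and end with \<open>1\<close>.
\<close>

fun line_from :: "bool \<Rightarrow> int list \<Rightarrow> bool" where
  "line_from s [] = s"
| "line_from s (a # as) = (\<exists>t. a = step s t \<and> line_from t as)"

abbreviation alternates :: "int list \<Rightarrow> bool" where
  "alternates \<equiv> successively (\<lambda>x y. sgn x = - sgn y)"

text \<open>
  The start value is encoded as an additional previous entry: \<open>1\<close> if the partial sum is \<open>1\<close>, and
  \<open>-1\<close> if it is \<open>0\<close>.
\<close>

lemma line_from_iff:
  "line_from s xs \<longleftrightarrow> set xs \<subseteq> {0, 1, - 1} \<and>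
     alternates ((if s then 1 else - 1) # filter (\<lambda>x. x \<noteq> 0) xs) \<and> sum_list xs = of_bool (\<not> s)"
proof (induction xs arbitrary: s)
  case (Cons a xs)
  show ?case
    by (cases s; cases "a = 0"; cases "a = 1"; cases "a = - 1")
       (auto simp: Cons.IH step_def ex_bool_eq)
qed auto

lemma alternates_sum:
  assumes "alternates (c # xs)" "c \<in> {1, - 1}" "set xs \<subseteq> {1, - 1}"
  shows "sum_list xs \<in> {0, - c}"
  using assms
proof (induction xs arbitrary: c)
  case (Cons a xs)
  have "sum_list xs \<in> {0, - a}" using Cons by auto
  moreover have "a = - c" using Cons.prems by auto
  ultimately show ?case by auto
qed simp

text \<open>
  An alternating line that starts with \<open>-1\<close> has sum \<open>0\<close> or \<open>-1\<close>, so sum \<open>1\<close> forces the first nonzero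
  entry to be \<open>1\<close>.
\<close>

lemma alternating_line_iff: "alternating_line xs \<longleftrightarrow> line_from False xs"
proof -
  let ?f = "filter (\<lambda>x. x \<noteq> 0) xs"
  have sum: "sum_list ?f = sum_list xs" by (induction xs) auto
  have "alternates ((- 1) # ?f)" if "set xs \<subseteq> {0, 1, - 1}" "alternates ?f" "sum_list xs = 1"
  proof (cases ?f)
    case (Cons c r)
    have "set ?f \<subseteq> {1, - 1}" using that(1) by auto
    then have c: "c \<in> {1, - 1}" "set r \<subseteq> {1, - 1}" using Cons by auto
    have "sum_list r \<in> {0, - c}" using alternates_sum[of c r] that(2) c Cons by simp
    moreover have "c + sum_list r = 1" using sum that(3) Cons by simp
    ultimately have "c = 1" using c by auto
    then show ?thesis using that(2) Cons by simp
  qed simp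
  moreover have "alternates ?f" if "alternates ((- 1) # ?f)"
    using that by (cases ?f) simp_all
  ultimately show ?thesis
    unfolding alternating_line_def line_from_iff by auto
qed

text \<open>
  The symmetric matrices that complete given partial sums \<open>bs\<close> to alternating lines: the possible
  lower right blocks of a matrix whose first rows are known.
\<close>

definition sym_mats :: "bool list \<Rightarrow> int mat set" where
  "sym_mats bs = {A \<in> carrier_mat (length bs) (length bs). transpose_mat A = A \<and>
     (\<forall>i < length bs. line_from (bs ! i) (list_of_vec (row A i)))}"

lemma DSASM_eq_sym_mats: "DSASM n = sym_mats (replicate n False)"
proof -
  have "col A j = row A j" if "transpose_mat A = A" "A \<in> carrier_mat n n" "j < n" for A :: "int mat" and j
    using that by (metis carrier_matD(1) row_transpose carrier_matD(2))
  then show ?thesis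
    by (auto simp: DSASM_def sym_mats_def is_ASM_def alternating_line_iff square_mat.simps)
qed

text \<open>
  The column sums that can leave a row which enters with \<open>h\<close> and \<open>bs\<close>.
\<close>

definition next_words :: "bool \<Rightarrow> bool list \<Rightarrow> bool list set" where
  "next_words h bs = {cs. length cs = length bs \<and> line_from h (map2 step bs cs)}"

lemma next_words_Nil: "next_words h [] = (if h then {[]} else {})"
  by (auto simp: next_words_def)

lemma next_words_Cons:
  "next_words h (b # bs) =
     (if h = b then (#) b ` next_words h bs \<union> (#) (\<not> b) ` next_words (\<not> h) bs
      else (#) b ` next_words h bs)"
proof (rule Set.set_eqI)
  fix w
  show "w \<in> next_words h (b # bs) \<longleftrightarrow> w \<in>
     (if h = b then (#) b ` next_words h bs \<union> (#) (\<not> b) ` next_words (\<not> h) bs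
      else (#) b ` next_words h bs)"
    by (cases w; cases h; cases b; cases "hd w")
       (auto simp: next_words_def step_def ex_bool_eq)
qed

lemma finite_next_words [simp]: "finite (next_words h bs)"
  by (rule finite_subset[OF _ finite_lists_length_eq[of UNIV "length bs"]]) (auto simp: next_words_def)

lemma row_transfer_zero:
  "row_transfer (0::'a::comm_ring_1) h (replicate (length bs) 0) F bs = (\<Sum>cs\<in>next_words h bs. F cs)"
proof (induction bs arbitrary: h F)
  case Nil
  then show ?case by (simp add: next_words_Nil)
next
  case (Cons b bs)
  have inj: "inj_on ((#) c) X" for c :: bool and X by (auto simp: inj_on_def)
  have "(#) True ` X \<inter> (#) False ` Y = {}" "(#) False ` X \<inter> (#) True ` Y = {}" for X Y by auto
  then show ?case
    by (simp add: Cons.IH next_words_Cons sum.union_disjoint sum.reindex[OF inj] turn_factor_def)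
qed

definition extend_mat :: "bool \<Rightarrow> bool list \<Rightarrow> bool \<Rightarrow> bool list \<Rightarrow> int mat \<Rightarrow> int mat" where
  "extend_mat b bs h cs A = mat (Suc (length bs)) (Suc (length bs)) (\<lambda>(i, j).
     if i = 0 then (if j = 0 then step b h else step (bs ! (j - 1)) (cs ! (j - 1)))
     else if j = 0 then step (bs ! (i - 1)) (cs ! (i - 1)) else A $$ (i - 1, j - 1))"

lemma list_of_vec_row:
  "A \<in> carrier_mat n m \<Longrightarrow> i < n \<Longrightarrow> list_of_vec (row A i) = map (\<lambda>j. A $$ (i, j)) [0..<m]"
  by (intro nth_equalityI) (auto simp: list_of_vec_index)

lemma extend_mat_rows:
  assumes "length cs = length bs" "A \<in> carrier_mat (length bs) (length bs)"
  shows "list_of_vec (row (extend_mat b bs h cs A) 0) = step b h # map2 step bs cs"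
    "i < length bs \<Longrightarrow> list_of_vec (row (extend_mat b bs h cs A) (Suc i)) =
        step (bs ! i) (cs ! i) # list_of_vec (row A i)"
proof -
  have c: "extend_mat b bs h cs A \<in> carrier_mat (Suc (length bs)) (Suc (length bs))"
    by (simp add: extend_mat_def)
  show "list_of_vec (row (extend_mat b bs h cs A) 0) = step b h # map2 step bs cs"
    by (subst list_of_vec_row[OF c], simp, intro nth_equalityI)
       (use assms in \<open>auto simp: extend_mat_def nth_Cons' simp del: upt_Suc\<close>)
  show "list_of_vec (row (extend_mat b bs h cs A) (Suc i)) =
        step (bs ! i) (cs ! i) # list_of_vec (row A i)" if "i < length bs"
    by (subst list_of_vec_row[OF c], use that in simp, subst list_of_vec_row[OF assms(2) that], intro nth_equalityI)
       (use assms that in \<open>auto simp: extend_mat_def nth_Cons' simp del: upt_Suc\<close>)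
qed

text \<open>
  Splitting off the first row, which is also the first column.
\<close>

lemma sym_mats_Cons:
  "bij_betw (\<lambda>((h, cs), A). extend_mat b bs h cs A)
     (SIGMA p : (SIGMA h : UNIV. next_words h bs). sym_mats (snd p)) (sym_mats (b # bs))"
  (is "bij_betw ?E ?S ?T")
proof (rule bij_betw_imageI)
  let ?n = "length bs"
  have len: "length cs = ?n" if "cs \<in> next_words h bs" for h cs
    using that by (simp add: next_words_def)
  show "inj_on ?E ?S"
  proof (rule inj_onI, clarsimp)
    fix h cs A h' cs' A'
    assume cs: "cs \<in> next_words h bs" "A \<in> sym_mats cs" and cs': "cs' \<in> next_words h' bs" "A' \<in> sym_mats cs'"
      and eq: "extend_mat b bs h cs A = extend_mat b bs h' cs' A'"
    have A: "A \<in> carrier_mat ?n ?n" "A' \<in> carrier_mat ?n ?n"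
      using cs cs' len by (auto simp: sym_mats_def)
    have e: "extend_mat b bs h cs A $$ (i, j) = extend_mat b bs h' cs' A' $$ (i, j)" for i j
      by (simp only: eq)
    have "h = h'" using e[of 0 0] by (simp add: extend_mat_def)
    moreover have "cs = cs'"
    proof (rule nth_equalityI)
      show "length cs = length cs'" using len cs cs' by simp
      fix i assume "i < length cs"
      then show "cs ! i = cs' ! i" using e[of 0 "Suc i"] len[OF cs(1)] by (simp add: extend_mat_def)
    qed
    moreover have "A = A'"
    proof (rule eq_matI)
      fix i j assume "i < dim_row A'" "j < dim_col A'"
      then show "A $$ (i, j) = A' $$ (i, j)" using e[of "Suc i" "Suc j"] A by (simp add: extend_mat_def)
    qed (use A in auto)
    ultimately show "h = h' \<and> cs = cs' \<and> A = A'" by blast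
  qed
  show "?E ` ?S = ?T"
  proof (intro equalityI subsetI)
    fix M assume "M \<in> ?E ` ?S"
    then obtain h cs A where M: "M = extend_mat b bs h cs A" and cs: "cs \<in> next_words h bs" and A: "A \<in> sym_mats cs"
      by auto
    have c: "length cs = ?n" "A \<in> carrier_mat ?n ?n" "transpose_mat A = A"
      using cs A len by (auto simp: sym_mats_def)
    have sym: "A $$ (i, j) = A $$ (j, i)" if "i < ?n" "j < ?n" for i j
      using c(2,3) that by (metis carrier_matD index_transpose_mat(1))
    have "transpose_mat M = M"
      unfolding M by (rule eq_matI) (auto simp: extend_mat_def sym)
    moreover have "line_from ((b # bs) ! i) (list_of_vec (row M i))" if "i < Suc ?n" for i
    proof (cases i)
      case 0
      then show ?thesis using extend_mat_rows(1)[OF c(1,2)] cs by (auto simp: M next_words_def)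
    next
      case (Suc k)
      then show ?thesis using extend_mat_rows(2)[OF c(1,2), of k] A that c by (auto simp: M sym_mats_def)
    qed
    ultimately show "M \<in> ?T" by (simp add: sym_mats_def M extend_mat_def)
  next
    fix M assume "M \<in> ?T"
    then have M: "M \<in> carrier_mat (Suc ?n) (Suc ?n)" "transpose_mat M = M"
      and rows: "\<And>i. i < Suc ?n \<Longrightarrow> line_from ((b # bs) ! i) (list_of_vec (row M i))"
      by (auto simp: sym_mats_def)
    have sym: "M $$ (i, j) = M $$ (j, i)" if "i < Suc ?n" "j < Suc ?n" for i j
      using M that by (metis carrier_matD index_transpose_mat(1))
    define A where "A = mat ?n ?n (\<lambda>(i, j). M $$ (Suc i, Suc j))"
    have A: "A \<in> carrier_mat ?n ?n" by (simp add: A_def)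
    have row_split: "list_of_vec (row M i) = M $$ (i, 0) # map (\<lambda>j. M $$ (i, Suc j)) [0..<?n]" if "i < Suc ?n" for i
      using that by (subst list_of_vec_row[OF M(1)]) (auto simp: upt_conv_Cons map_Suc_upt[symmetric] simp del: upt_Suc)
    obtain h where h: "M $$ (0, 0) = step b h" "line_from h (map (\<lambda>j. M $$ (0, Suc j)) [0..<?n])"
      using rows[of 0] row_split[of 0] by auto
    have "\<exists>c. M $$ (Suc i, 0) = step (bs ! i) c \<and> line_from c (list_of_vec (row A i))" if "i < ?n" for i
    proof -
      have "list_of_vec (row A i) = map (\<lambda>j. M $$ (Suc i, Suc j)) [0..<?n]"
        using that by (subst list_of_vec_row[OF A]) (auto simp: A_def)
      then show ?thesis using rows[of "Suc i"] row_split[of "Suc i"] that by auto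
    qed
    then obtain c where c: "\<And>i. i < ?n \<Longrightarrow> M $$ (Suc i, 0) = step (bs ! i) (c i)"
        "\<And>i. i < ?n \<Longrightarrow> line_from (c i) (list_of_vec (row A i))"
      by metis
    define cs where "cs = map c [0..<?n]"
    have len: "length cs = ?n" by (simp add: cs_def)
    have "map (\<lambda>j. M $$ (0, Suc j)) [0..<?n] = map2 step bs cs"
      by (rule nth_equalityI) (use c(1) sym[of 0] in \<open>auto simp: cs_def\<close>)
    then have "cs \<in> next_words h bs" using h len by (simp add: next_words_def)
    moreover have "A \<in> sym_mats cs"
      using A c(2) len sym unfolding sym_mats_def by (auto simp: cs_def A_def)
    moreover have "M = extend_mat b bs h cs A"
    proof (rule eq_matI)
      fix i j assume "i < dim_row (extend_mat b bs h cs A)" "j < dim_col (extend_mat b bs h cs A)"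
      then have ij: "i < Suc ?n" "j < Suc ?n" by (simp_all add: extend_mat_def)
      show "M $$ (i, j) = extend_mat b bs h cs A $$ (i, j)"
      proof (cases i)
        case 0
        then show ?thesis
          using ij h(1) c(1)[of "j - 1"] sym[of 0 j] by (cases j) (simp_all add: extend_mat_def cs_def)
      next
        case (Suc k)
        then show ?thesis
          using ij c(1)[of k] by (cases j) (simp_all add: extend_mat_def A_def cs_def)
      qed
    qed (use M in \<open>simp_all add: extend_mat_def\<close>)
    ultimately show "M \<in> ?E ` ?S" by force
  qed
qed

lemma sym_mats_count:
  "finite (sym_mats bs) \<and>
   of_nat (card (sym_mats bs)) = triangle_weight (replicate (length bs) (0::'a::comm_ring_1)) bs"
proof (induction "length bs" arbitrary: bs)
  case 0
  have "sym_mats [] = {mat 0 0 (\<lambda>_. 0)}"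
    by (auto simp: sym_mats_def intro!: eq_matI)
  then show ?case using 0 by simp
next
  case (Suc n)
  then obtain b w where bs: "bs = b # w" and n: "length w = n" by (cases bs) auto
  have IH: "finite (sym_mats cs)"
    "of_nat (card (sym_mats cs)) = triangle_weight (replicate n (0::'a)) cs" if "cs \<in> next_words h w" for h cs
    using Suc.hyps(1)[of cs] that n by (auto simp: next_words_def)
  let ?P = "SIGMA h : UNIV. next_words h w"
  have fin: "finite ?P" by (intro finite_SigmaI) simp_all
  have finS: "finite (SIGMA p : ?P. sym_mats (snd p))"
    using IH(1) by (intro finite_SigmaI fin) auto
  have "card (sym_mats bs) = (\<Sum>p\<in>?P. card (sym_mats (snd p)))"
    unfolding bs bij_betw_same_card[OF sym_mats_Cons, symmetric]
    using IH(1) by (intro card_SigmaI fin) auto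
  also have "\<dots> = (\<Sum>h\<in>UNIV. \<Sum>cs\<in>next_words h w. card (sym_mats cs))"
    by (subst sum.Sigma) (auto intro!: sum.cong)
  finally have "of_nat (card (sym_mats bs)) = (\<Sum>h\<in>UNIV. \<Sum>cs\<in>next_words h w. triangle_weight (replicate n (0::'a)) cs)"
    using IH(2) by simp
  then show ?case
    using bij_betw_finite[OF sym_mats_Cons[of b w]] finS
    by (simp add: bs n UNIV_bool diag_weight_def turn_factor_def row_transfer_zero[of _ w, unfolded n])
qed

lemma card_DSASM: "of_nat (card (DSASM n)) = partition_fn (replicate n (0::'a::comm_ring_1))"
  using sym_mats_count[of "replicate n False", where 'a = 'a] by (simp add: DSASM_eq_sym_mats partition_fn_def)

section \<open>Coefficients of the generating function\<close>

definition kappa :: "nat \<Rightarrow> rat" where "kappa k = (if k = 0 then 2 else 3)"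

text \<open>
  The coefficients of \<open>(v - u) / (1 - u - v)\<close>.
\<close>

definition ballot :: "nat \<Rightarrow> nat \<Rightarrow> rat" where
  "ballot i j = (if j = 0 then 0 else of_nat ((i + j - 1) choose i))
              - (if i = 0 then 0 else of_nat ((i + j - 1) choose j))"

lemma coeff_uv_u [simp]: "coeff_uv i j (u_var * f) = (if i = 0 then 0 else coeff_uv (i - 1) j f)"
  by (simp add: coeff_uv_def u_var_def)

lemma coeff_uv_v [simp]: "coeff_uv i j (v_var * f) = (if j = 0 then 0 else coeff_uv i (j - 1) f)"
  by (simp add: coeff_uv_def v_var_def)

lemma coeff_uv_add [simp]: "coeff_uv i j (f + g) = coeff_uv i j f + coeff_uv i j g"
  and coeff_uv_diff [simp]: "coeff_uv i j (f - g) = coeff_uv i j f - coeff_uv i j g"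
  by (simp_all add: coeff_uv_def)

lemma coeff_uv_1: "coeff_uv i j 1 = (if i = 0 \<and> j = 0 then 1 else 0)"
  using coeff_uv_monomial[of i j 0 0] by simp

lemma coeff_uv_eqI: "(\<And>i j. coeff_uv i j f = coeff_uv i j g) \<Longrightarrow> f = g"
  by (simp add: coeff_uv_def fps_eq_iff)

text \<open>
  The series \<open>1 / (1 - u - v)\<close>.
\<close>

definition pascal :: "rat fps fps" where
  "pascal = Abs_fps (\<lambda>j. Abs_fps (\<lambda>i. of_nat ((i + j) choose i)))"

lemma pascal_eq: "pascal - u_var * pascal - v_var * pascal = 1"
proof (rule coeff_uv_eqI)
  have c: "coeff_uv i j pascal = of_nat ((i + j) choose i)" for i j
    by (simp add: pascal_def coeff_uv_def)
  show "coeff_uv i j (pascal - u_var * pascal - v_var * pascal) = coeff_uv i j 1" for i j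
    by (cases i; cases j) (simp_all add: c coeff_uv_1 add.commute)
qed

text \<open>
  The series \<open>(2 + u v) / (1 - u v)\<close>.
\<close>

definition diagonal :: "rat fps fps" where
  "diagonal = Abs_fps (\<lambda>k. fps_const (kappa k) * fps_X ^ k)"

lemma diagonal_eq: "diagonal - u_var * (v_var * diagonal) = 2 + u_var * v_var"
proof -
  have c: "coeff_uv i j diagonal = (if i = j then kappa i else 0)" for i j
    by (simp add: diagonal_def coeff_uv_def fps_X_power_nth)
  have "diagonal - u_var * (v_var * diagonal) = 1 + 1 + u_var * (v_var * 1)"
  proof (rule coeff_uv_eqI)
    show "coeff_uv i j (diagonal - u_var * (v_var * diagonal)) = coeff_uv i j (1 + 1 + u_var * (v_var * 1))" for i j
      unfolding coeff_uv_add coeff_uv_diff coeff_uv_u coeff_uv_v coeff_uv_1 c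
      by (auto simp: kappa_def)
  qed
  then show ?thesis by simp
qed

lemma dsasm_gf_eq: "dsasm_gf = (v_var - u_var) * pascal * diagonal"
proof -
  let ?D = "(1 - u_var * v_var) * (1 - u_var - v_var)"
  have "(v_var - u_var) * pascal * diagonal * ?D =
      (v_var - u_var) * (pascal - u_var * pascal - v_var * pascal) * (diagonal - u_var * (v_var * diagonal))"
    by (simp add: algebra_simps)
  also have "\<dots> = dsasm_gf * ?D"
    unfolding pascal_eq diagonal_eq dsasm_gf_times_denominator by simp
  finally have eq: "(v_var - u_var) * pascal * diagonal * ?D = dsasm_gf * ?D" .
  have "fps_nth (fps_nth ?D 0) 0 = 1" by (simp add: u_var_def v_var_def)
  then have "?D \<noteq> 0" by (metis fps_zero_nth zero_neq_one)
  then show ?thesis using eq by (metis mult_right_cancel)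
qed

lemma coeff_dsasm_gf:
  "coeff_uv i j dsasm_gf = (\<Sum>k\<le>min i j. kappa k * ballot (i - k) (j - k))"
proof -
  have c: "coeff_uv i j ((v_var - u_var) * pascal) = ballot i j" for i j
  proof -
    have "(i + j - 1) choose (i - 1) = (i + j - 1) choose j" if "i > 0"
      using that binomial_symmetric[of j "i - 1 + j"] by simp
    then show ?thesis
      unfolding left_diff_distrib coeff_uv_diff coeff_uv_u coeff_uv_v
      by (cases i; cases j) (simp_all add: ballot_def pascal_def coeff_uv_def)
  qed
  define f where "f = (v_var - u_var) * pascal"
  have nth: "fps_nth (fps_const q * fps_X ^ k * g) i = (if k \<le> i then q * fps_nth g (i - k) else 0)"
    for q :: rat and k g
    by (simp add: mult.assoc fps_X_power_mult_nth)
  have "coeff_uv i j dsasm_gf = (\<Sum>k=0..j. if k \<le> i then kappa k * coeff_uv (i - k) (j - k) f else 0)"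
    unfolding dsasm_gf_eq mult.commute[of _ diagonal] coeff_uv_def f_def[symmetric] fps_mult_nth[of diagonal] fps_sum_nth
    by (simp only: diagonal_def fps_nth_Abs_fps nth)
  also have "\<dots> = (\<Sum>k\<in>{k\<in>{0..j}. k \<le> i}. kappa k * ballot (i - k) (j - k))"
    unfolding c[folded f_def] by (rule sum.inter_filter[symmetric]) simp
  also have "{k\<in>{0..j}. k \<le> i} = {..min i j}" by auto
  finally show ?thesis .
qed

lemma coeff_dsasm_gf_skew: "coeff_uv i j dsasm_gf = - coeff_uv j i dsasm_gf"
proof -
  have "ballot i j = - ballot j i" for i j by (simp add: ballot_def add.commute)
  then show ?thesis unfolding coeff_dsasm_gf min.commute[of j i] sum_negf[symmetric]
    by (intro sum.cong refl) (metis mult_minus_right)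
qed

lemma ballot_less:
  assumes "i < j"
  shows "ballot i j = of_nat ((i + j - 1) choose i) - of_nat ((i + j - 1) choose j)"
  using assms by (simp add: ballot_def)

lemma ballot_less':
  assumes "i < j"
  shows "ballot i j = (of_nat j - of_nat i) / of_nat (i + j) * of_nat ((i + j) choose i)"
proof -
  define n where "n = i + j"
  have "j * (n choose i) = n * ((n - 1) choose i)" "i * (n choose j) = n * ((n - 1) choose j)"
    using binomial_absorb_comp[of n i] binomial_absorb_comp[of n j] by (simp_all add: n_def)
  moreover have "n choose j = n choose i" using binomial_symmetric[of i n] by (simp add: n_def)
  ultimately have "of_nat j * of_nat (n choose i) = (of_nat n * of_nat ((n - 1) choose i) :: rat)"
    "of_nat i * of_nat (n choose i) = (of_nat n * of_nat ((n - 1) choose j) :: rat)"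
    by (simp_all only: of_nat_mult[symmetric])
  moreover have "of_nat n \<noteq> (0::rat)" using assms by (simp add: n_def)
  ultimately show ?thesis
    unfolding ballot_less[OF assms] n_def[symmetric] by (simp add: field_simps)
qed

lemma coeff_dsasm_gf_explicit:
  assumes "i < j"
  shows "coeff_uv i j dsasm_gf =
             (\<Sum>k=0..i. (3 - kronecker_delta k 0) *
                (of_nat ((i + j - 2 * k - 1) choose (i - k))
                 - of_nat ((i + j - 2 * k - 1) choose (j - k))))" (is ?A)
    and "coeff_uv i j dsasm_gf =
             (of_nat j - of_nat i) *
             (\<Sum>k=0..i. (3 - kronecker_delta k 0) / of_nat (i + j - 2 * k) *
                of_nat ((i + j - 2 * k) choose (i - k)))" (is ?B)
proof -
  have kap: "kappa k = 3 - kronecker_delta k 0" for k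
    by (simp add: kappa_def kronecker_delta_def)
  have s: "coeff_uv i j dsasm_gf = (\<Sum>k=0..i. kappa k * ballot (i - k) (j - k))"
    using assms by (simp add: coeff_dsasm_gf atMost_atLeast0)
  have ix: "i - k + (j - k) = i + j - 2 * k" if "k \<le> i" for k using that assms by simp
  show ?A
    unfolding s
  proof (rule sum.cong[OF refl])
    fix k assume "k \<in> {0..i}"
    then have "k \<le> i" "i - k < j - k" using assms by auto
    then show "kappa k * ballot (i - k) (j - k) = (3 - kronecker_delta k 0) *
                (of_nat ((i + j - 2 * k - 1) choose (i - k))
                 - of_nat ((i + j - 2 * k - 1) choose (j - k)))"
      by (simp only: kap ballot_less ix)
  qed
  show ?B
    unfolding s sum_distrib_left
  proof (rule sum.cong[OF refl])
    fix k assume "k \<in> {0..i}"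
    then have k: "k \<le> i" "i - k < j - k" using assms by auto
    have d: "(of_nat (j - k) - of_nat (i - k) :: rat) = of_nat j - of_nat i"
      using k assms by (simp add: of_nat_diff)
    show "kappa k * ballot (i - k) (j - k) = (of_nat j - of_nat i) *
        ((3 - kronecker_delta k 0) / of_nat (i + j - 2 * k) * of_nat ((i + j - 2 * k) choose (i - k)))"
      unfolding ballot_less'[OF k(2)] ix[OF k(1)] d kap by simp
  qed
qed

text \<open>
  Substitution of \<open>c t\<close> for \<open>u\<close> and of \<open>d t\<close> for \<open>v\<close>, where \<open>t\<close> is the variable of the resulting series.
\<close>

definition eval_line :: "rat \<Rightarrow> rat \<Rightarrow> rat fps fps \<Rightarrow> rat fps" where
  "eval_line c d f = Abs_fps (\<lambda>s. \<Sum>a\<le>s. coeff_uv a (s - a) f * c ^ a * d ^ (s - a))"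

lemma eval_line_add: "eval_line c d (f + g) = eval_line c d f + eval_line c d g"
  and eval_line_diff: "eval_line c d (f - g) = eval_line c d f - eval_line c d g"
  by (simp_all add: eval_line_def fps_eq_iff algebra_simps sum.distrib sum_subtractf)

lemma eval_line_1: "eval_line c d 1 = 1"
proof (rule fps_ext)
  fix s
  have "(\<Sum>a\<le>s. coeff_uv a (s - a) 1 * c ^ a * d ^ (s - a)) = (\<Sum>a\<le>s. if a = 0 then (if s = 0 then 1 else 0) else 0)"
    by (intro sum.cong refl) (auto simp: coeff_uv_1)
  then show "fps_nth (eval_line c d 1) s = fps_nth 1 s" by (simp add: eval_line_def)
qed

lemma eval_line_u: "eval_line c d (u_var * f) = fps_const c * fps_X * eval_line c d f"
proof (rule fps_ext)
  fix s
  show "fps_nth (eval_line c d (u_var * f)) s = fps_nth (fps_const c * fps_X * eval_line c d f) s"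
  proof (cases s)
    case (Suc t)
    then show ?thesis
      by (simp add: eval_line_def mult.assoc sum.atMost_Suc_shift sum_distrib_left mult_ac del: sum.atMost_Suc)
  qed (simp add: eval_line_def mult.assoc)
qed

lemma eval_line_v: "eval_line c d (v_var * f) = fps_const d * fps_X * eval_line c d f"
proof (rule fps_ext)
  fix s
  show "fps_nth (eval_line c d (v_var * f)) s = fps_nth (fps_const d * fps_X * eval_line c d f) s"
  proof (cases s)
    case (Suc t)
    have "(\<Sum>a\<le>t. coeff_uv a (Suc t - a) (v_var * f) * c ^ a * d ^ (Suc t - a)) =
        (\<Sum>a\<le>t. d * (coeff_uv a (t - a) f * c ^ a * d ^ (t - a)))"
      by (intro sum.cong refl) (simp add: Suc_diff_le)
    then show ?thesis
      using Suc by (simp add: eval_line_def mult.assoc sum_distrib_left)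
  qed (simp add: eval_line_def mult.assoc)
qed

text \<open>
  Substitution respects sums and products with the two variables, which suffices to transport the
  defining equation of the quotient.
\<close>

lemma eval_line_dsasm_gf:
  fixes c d :: rat
  defines "x \<equiv> fps_const c * fps_X" and "y \<equiv> fps_const d * fps_X"
  shows "eval_line c d dsasm_gf * ((1 - x * y) * (1 - x - y)) = (y - x) * (2 + x * y)"
proof -
  let ?e = "eval_line c d"
  note ev = eval_line_add eval_line_diff eval_line_u eval_line_v eval_line_1 x_def[symmetric] y_def[symmetric]
  define h where "h = dsasm_gf - u_var * (v_var * dsasm_gf)"
  have "h - u_var * h - v_var * h = v_var * 1 + v_var * 1 - u_var * 1 - u_var * 1
      + v_var * (u_var * (v_var * 1)) - u_var * (u_var * (v_var * 1))"
    using dsasm_gf_times_denominator by (simp add: h_def algebra_simps)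
  then have "?e (h - u_var * h - v_var * h) = ?e (v_var * 1 + v_var * 1 - u_var * 1 - u_var * 1
      + v_var * (u_var * (v_var * 1)) - u_var * (u_var * (v_var * 1)))"
    by simp
  then have "?e h - x * ?e h - y * ?e h = y * 1 + y * 1 - x * 1 - x * 1 + y * (x * (y * 1)) - x * (x * (y * 1))"
    unfolding ev .
  moreover have "?e h = ?e dsasm_gf - x * (y * ?e dsasm_gf)" unfolding h_def ev ..
  ultimately show ?thesis by (simp add: algebra_simps)
qed

section \<open>Leading coefficients of Pfaffians of power series\<close>

text \<open>
  Among the sets of natural numbers of a given size, the initial segment is the unique one with the
  smallest sum.
\<close>

lemma card_le_sum_nats:
  fixes B :: "nat set"
  assumes "finite B"
  shows "\<Sum>{..<card B} \<le> \<Sum>B \<and> (\<Sum>B = \<Sum>{..<card B} \<longrightarrow> B = {..<card B})"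
  using assms
proof (induction "card B" arbitrary: B)
  case 0
  then show ?case by simp
next
  case (Suc n)
  define m where "m = Max B"
  have m: "m \<in> B" "B \<subseteq> {..m}" using Suc by (auto simp: m_def card_gt_0_iff intro!: Max_in)
  have "n \<le> m" using card_mono[OF _ m(2)] Suc(2) by simp
  have card: "card (B - {m}) = n" using m Suc by simp
  then have IH: "\<Sum>{..<n} \<le> \<Sum>(B - {m})" "\<Sum>(B - {m}) = \<Sum>{..<n} \<Longrightarrow> B - {m} = {..<n}"
    using Suc(1)[of "B - {m}"] Suc(3) by simp_all
  have s: "\<Sum>B = m + \<Sum>(B - {m})" using sum.remove[OF Suc(3) m(1), of "\<lambda>x. x"] by simp
  show ?case
  proof (intro conjI impI)
    show "\<Sum>{..<card B} \<le> \<Sum>B" using s IH(1) \<open>n \<le> m\<close> by (simp add: Suc(2)[symmetric])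
    assume "\<Sum>B = \<Sum>{..<card B}"
    then have "m = n" "B - {m} = {..<n}" using s IH \<open>n \<le> m\<close> by (auto simp: Suc(2)[symmetric])
    then have "B = insert n {..<n}" using insert_Diff[OF m(1)] by simp
    then show "B = {..<card B}" unfolding Suc(2)[symmetric] by (simp only: lessThan_Suc)
  qed
qed

lemma det_transversal:
  "det (mat N N (\<lambda>(i, j). u j (g i))) =
     (\<Sum>\<sigma> | \<sigma> permutes {..<N}. of_int (sign \<sigma>) * (\<Prod>i<N. u (\<sigma> i) (g i)))"
  for u :: "nat \<Rightarrow> 'b \<Rightarrow> 'a::comm_ring_1"
proof -
  have "(\<Prod>i = 0..<N. mat N N (\<lambda>(i, j). u j (g i)) $$ (i, \<sigma> i)) = (\<Prod>i<N. u (\<sigma> i) (g i))"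
    if "\<sigma> permutes {0..<N}" for \<sigma>
    unfolding atLeast0LessThan
  proof (rule prod.cong[OF refl])
    fix i assume "i \<in> {..<N}"
    then have "\<sigma> i < N" using permutes_in_image[OF that, of i] by simp
    then show "mat N N (\<lambda>(i, j). u j (g i)) $$ (i, \<sigma> i) = u (\<sigma> i) (g i)"
      using \<open>i \<in> {..<N}\<close> by simp
  qed
  then show ?thesis
    unfolding det_def lessThan_atLeast0 by simp
qed

lemma prod_pairs: "(\<Prod>i<2 * m. f i) = (\<Prod>k<m. f (2 * k) * f (2 * k + 1))"
  for f :: "nat \<Rightarrow> 'a::comm_monoid_mult"
  by (induction m) (simp_all add: mult_ac)

lemma prod_double_sum:
  fixes T :: "nat \<Rightarrow> 'b \<Rightarrow> 'b \<Rightarrow> 'a::comm_semiring_1"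
  assumes "finite J"
  shows "(\<Prod>k<m. \<Sum>a\<in>J. \<Sum>b\<in>J. T k a b) =
    (\<Sum>g\<in>{..<2 * m} \<rightarrow>\<^sub>E J. \<Prod>k<m. T k (g (2 * k)) (g (2 * k + 1)))"
proof -
  have "(\<Prod>k<m. \<Sum>a\<in>J. \<Sum>b\<in>J. T k a b) = (\<Prod>k<m. \<Sum>p\<in>J \<times> J. T k (fst p) (snd p))"
    by (simp add: sum.cartesian_product case_prod_beta)
  also have "\<dots> = (\<Sum>h\<in>{..<m} \<rightarrow>\<^sub>E J \<times> J. \<Prod>k<m. T k (fst (h k)) (snd (h k)))"
    by (rule prod_sum_PiE) (use assms in auto)
  also have "\<dots> = (\<Sum>g\<in>{..<2 * m} \<rightarrow>\<^sub>E J. \<Prod>k<m. T k (g (2 * k)) (g (2 * k + 1)))"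
  proof (rule sum.reindex_bij_witness[
      where i = "\<lambda>g. \<lambda>k\<in>{..<m}. (g (2 * k), g (2 * k + 1))" and
            j = "\<lambda>h. \<lambda>i\<in>{..<2 * m}. if even i then fst (h (i div 2)) else snd (h (i div 2))"])
    fix h assume h: "h \<in> {..<m} \<rightarrow>\<^sub>E J \<times> J"
    let ?g = "\<lambda>i\<in>{..<2 * m}. if even i then fst (h (i div 2)) else snd (h (i div 2))"
    have "(\<lambda>k\<in>{..<m}. (?g (2 * k), ?g (2 * k + 1))) k = h k" for k
      using PiE_arb[OF h, of k] by (cases "k < m") simp_all
    then show "(\<lambda>k\<in>{..<m}. (?g (2 * k), ?g (2 * k + 1))) = h" by (rule ext)
    have "(if even i then fst (h (i div 2)) else snd (h (i div 2))) \<in> J" if "i < 2 * m" for i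
    proof -
      have "h (i div 2) \<in> J \<times> J" using that by (intro PiE_mem[OF h]) simp
      then show ?thesis by (simp add: mem_Times_iff)
    qed
    then show "?g \<in> {..<2 * m} \<rightarrow>\<^sub>E J" by (intro restrict_PiE_iff[THEN iffD2] ballI) simp
    show "(\<Prod>k<m. T k (?g (2 * k)) (?g (2 * k + 1))) = (\<Prod>k<m. T k (fst (h k)) (snd (h k)))"
      by (rule prod.cong) simp_all
  next
    fix g assume g: "g \<in> {..<2 * m} \<rightarrow>\<^sub>E J"
    let ?h = "\<lambda>k\<in>{..<m}. (g (2 * k), g (2 * k + 1))"
    have "(\<lambda>i\<in>{..<2 * m}. if even i then fst (?h (i div 2)) else snd (?h (i div 2))) i = g i" for i
    proof (cases "i < 2 * m")
      case True
      then show ?thesis by (cases "even i") (auto elim!: evenE oddE)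
    next
      case False
      then show ?thesis using PiE_arb[OF g, of i] by simp
    qed
    then show "(\<lambda>i\<in>{..<2 * m}. if even i then fst (?h (i div 2)) else snd (?h (i div 2))) = g"
      by (rule ext)
    have "(g (2 * k), g (2 * k + 1)) \<in> J \<times> J" if "k < m" for k
      using that by (intro SigmaI PiE_mem[OF g]) simp_all
    then show "?h \<in> {..<m} \<rightarrow>\<^sub>E J \<times> J" by (intro restrict_PiE_iff[THEN iffD2] ballI) simp
  qed
  finally show ?thesis .
qed

text \<open>
  The analogue of the Cauchy--Binet formula for the Pfaffian of \<open>U F U\<^sup>T\<close>.  The sum runs over all
  choice functions and not only over increasing ones, so the row selections need not be injective.
\<close>

lemma pfaffian_sum_expand:
  fixes u :: "nat \<Rightarrow> 'b \<Rightarrow> 'a::comm_ring_1" and F :: "'b \<Rightarrow> 'b \<Rightarrow> 'a"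
  assumes "finite J" "even N"
  shows "pfaffian_sum N (\<lambda>i j. \<Sum>a\<in>J. \<Sum>b\<in>J. u i a * F a b * u j b) =
    (\<Sum>g\<in>{..<N} \<rightarrow>\<^sub>E J. (\<Prod>k<N div 2. F (g (2 * k)) (g (2 * k + 1))) * det (mat N N (\<lambda>(i, j). u j (g i))))"
proof -
  define m where "m = N div 2"
  have N: "N = 2 * m" using assms(2) by (simp add: m_def)
  let ?G = "{..<N} \<rightarrow>\<^sub>E J"
  let ?F = "\<lambda>g. \<Prod>k<N div 2. F (g (2 * k)) (g (2 * k + 1))"
  have split: "(\<Prod>i<N. u (\<sigma> i) (g i)) =
      (\<Prod>k<m. u (\<sigma> (2 * k)) (g (2 * k)) * u (\<sigma> (2 * k + 1)) (g (2 * k + 1)))" for \<sigma> g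
    by (simp only: N prod_pairs)
  have "pfaffian_sum N (\<lambda>i j. \<Sum>a\<in>J. \<Sum>b\<in>J. u i a * F a b * u j b) =
     (\<Sum>\<sigma> | \<sigma> permutes {..<N}. \<Sum>g\<in>?G. ?F g * (of_int (sign \<sigma>) * (\<Prod>i<N. u (\<sigma> i) (g i))))"
    unfolding pfaffian_sum_def m_def[symmetric] prod_double_sum[OF assms(1)] N[symmetric] sum_distrib_left
    by (intro sum.cong refl) (simp only: split prod.distrib mult_ac)
  also have "\<dots> = (\<Sum>g\<in>?G. \<Sum>\<sigma> | \<sigma> permutes {..<N}. ?F g * (of_int (sign \<sigma>) * (\<Prod>i<N. u (\<sigma> i) (g i))))"
    by (rule sum.swap)
  also have "\<dots> = (\<Sum>g\<in>?G. ?F g * det (mat N N (\<lambda>(i, j). u j (g i))))"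
    unfolding det_transversal sum_distrib_left ..
  finally show ?thesis .
qed

text \<open>
  Row operations with determinant \<open>1\<close> that bring a matrix to triangular form.
\<close>

lemma det_unitriangular_mult:
  fixes U L T :: "nat \<Rightarrow> nat \<Rightarrow> 'a::idom"
  assumes L: "\<And>i. i < N \<Longrightarrow> L i i = 1" "\<And>i a. i < a \<Longrightarrow> L i a = 0"
    and LU: "\<And>i j. i < N \<Longrightarrow> j < N \<Longrightarrow> (\<Sum>a<N. L i a * U j a) = T i j"
    and T: "\<And>i j. j < i \<Longrightarrow> i < N \<Longrightarrow> T i j = 0"
  shows "det (mat N N (\<lambda>(i, j). U j i)) = (\<Prod>i<N. T i i)"
proof -
  let ?L = "mat N N (\<lambda>(i, j). L i j)" and ?U = "mat N N (\<lambda>(i, j). U j i)" and ?T = "mat N N (\<lambda>(i, j). T i j)"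
  have prod: "prod_list (diag_mat (mat N N (\<lambda>(i, j). A i j))) = (\<Prod>i<N. A i i)" for A :: "nat \<Rightarrow> nat \<Rightarrow> 'a"
    unfolding prod_list_diag_prod by (simp add: lessThan_atLeast0)
  have "?L * ?U = ?T"
    by (rule eq_matI) (auto simp: scalar_prod_def LU[symmetric] lessThan_atLeast0)
  then have "det ?L * det ?U = det ?T"
    by (metis det_mult mat_carrier)
  moreover have "det ?L = (\<Prod>i<N. L i i)"
    unfolding prod[symmetric] by (rule det_lower_triangular[of N]) (auto simp: L)
  moreover have "det ?T = (\<Prod>i<N. T i i)"
    unfolding prod[symmetric] by (rule det_upper_triangular[of _ N]) (auto simp: T)
  ultimately show ?thesis using L(1) by simp
qed

text \<open>
  Equality modulo \<open>t\<close> to the power \<open>K + 1\<close>; it permits replacing infinite expansions by finite sums.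
\<close>

definition agree_upto :: "nat \<Rightarrow> 'a::comm_ring_1 fps \<Rightarrow> 'a fps \<Rightarrow> bool" where
  "agree_upto K f g \<longleftrightarrow> (\<forall>k\<le>K. fps_nth f k = fps_nth g k)"

lemma agree_upto_mult: "agree_upto K f g \<Longrightarrow> agree_upto K f' g' \<Longrightarrow> agree_upto K (f * f') (g * g')"
  unfolding agree_upto_def fps_mult_nth by (intro allI impI sum.cong) auto

lemma agree_upto_prod: "(\<And>i. i \<in> I \<Longrightarrow> agree_upto K (f i) (g i)) \<Longrightarrow> agree_upto K (\<Prod>i\<in>I. f i) (\<Prod>i\<in>I. g i)"
proof (induction I rule: infinite_finite_induct)
  case (insert i I)
  then show ?case by (simp add: agree_upto_mult)
qed (simp_all add: agree_upto_def)

lemma agree_upto_pfaffian_sum: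
  assumes "\<And>i j. i < N \<Longrightarrow> j < N \<Longrightarrow> agree_upto K (A i j) (B i j)"
  shows "agree_upto K (pfaffian_sum N A) (pfaffian_sum N B)"
proof -
  have "agree_upto K (of_int (sign \<sigma>) * (\<Prod>k<N div 2. A (\<sigma> (2 * k)) (\<sigma> (2 * k + 1))))
      (of_int (sign \<sigma>) * (\<Prod>k<N div 2. B (\<sigma> (2 * k)) (\<sigma> (2 * k + 1))))" if s: "\<sigma> permutes {..<N}" for \<sigma>
  proof (intro agree_upto_mult agree_upto_prod assms)
    fix k assume "k \<in> {..<N div 2}"
    then have "2 * k < N" "2 * k + 1 < N" by auto
    then show "\<sigma> (2 * k) < N" "\<sigma> (2 * k + 1) < N"
      using permutes_in_image[OF s] by (simp_all del: lessThan_iff add: lessThan_iff[symmetric])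
  qed (simp add: agree_upto_def)
  then show ?thesis
    unfolding pfaffian_sum_def agree_upto_def fps_sum_nth by (auto intro!: sum.cong)
qed

lemma det_rows_permuted:
  fixes u :: "nat \<Rightarrow> nat \<Rightarrow> 'a::comm_ring_1"
  assumes "p permutes {..<N}"
  shows "det (mat N N (\<lambda>(i, j). u j (p i))) = of_int (sign p) * det (mat N N (\<lambda>(i, j). u j i))"
proof -
  have p: "p permutes {0..<N}" using assms by (simp add: lessThan_atLeast0)
  have "det (mat N N (\<lambda>(i, j). mat N N (\<lambda>(i, j). u j i) $$ (p i, j))) = of_int (sign p) * det (mat N N (\<lambda>(i, j). u j i))"
    by (rule det_permute_rows[OF _ p]) simp
  moreover have "mat N N (\<lambda>(i, j). mat N N (\<lambda>(i, j). u j i) $$ (p i, j)) = mat N N (\<lambda>(i, j). u j (p i))"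
    using permutes_in_image[OF p] by (intro eq_matI) auto
  ultimately show ?thesis by simp
qed

text \<open>
  If row \<open>i\<close> is homogeneous of degree \<open>w (g i)\<close> in \<open>t\<close>, then so is the determinant.
\<close>

lemma det_graded:
  fixes u :: "nat \<Rightarrow> nat \<Rightarrow> 'a::comm_ring_1"
  shows "det (mat N N (\<lambda>(i, j). fps_const (u j (g i)) * fps_X ^ w (g i))) =
    fps_const (det (mat N N (\<lambda>(i, j). u j (g i)))) * fps_X ^ (\<Sum>i<N. w (g i))"
proof -
  have const: "(\<Prod>i\<in>I. fps_const (f i)) = fps_const (\<Prod>i\<in>I. f i)" for f :: "nat \<Rightarrow> 'a" and I
    by (induction I rule: infinite_finite_induct) auto
  have sum: "(\<Sum>\<sigma>\<in>S. fps_const (h \<sigma>)) = fps_const (\<Sum>\<sigma>\<in>S. h \<sigma>)" for h :: "(nat \<Rightarrow> nat) \<Rightarrow> 'a" and S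
    by (induction S rule: infinite_finite_induct) auto
  have int: "of_int z = fps_const (of_int z :: 'a)" for z
    by (simp add: fps_of_int)
  show ?thesis
    unfolding det_transversal[of N "\<lambda>j a. fps_const (u j a) * fps_X ^ w a"] det_transversal[of N u]
      prod.distrib const int power_sum[symmetric] sum[symmetric] sum_distrib_right
      fps_const_mult[symmetric] mult.assoc ..
qed

text \<open>
  The entries are \<open>\<Sum>\<^sub>a\<^sub>b u\<^sub>i\<^sub>a F\<^sub>a\<^sub>b u\<^sub>j\<^sub>b t\<^sup>w\<^sup>(\<^sup>a\<^sup>)\<^sup>+\<^sup>w\<^sup>(\<^sup>b\<^sup>)\<close> up to the order in question.  By assumption
  \<open>lead\<close> a nonzero determinant of degree at most \<open>K\<close> belongs to a permutation; the permutations contribute the sign of the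
  permutation times a common determinant, which leaves the Pfaffian sum of \<open>F\<close>.
\<close>

lemma pfaffian_sum_leading_coeff:
  fixes u F :: "nat \<Rightarrow> nat \<Rightarrow> 'a::comm_ring_1"
  assumes N: "even N" "N \<le> Suc M"
    and A: "\<And>i j k. i < N \<Longrightarrow> j < N \<Longrightarrow> k \<le> K \<Longrightarrow> fps_nth (A i j) k =
        (\<Sum>a\<le>M. \<Sum>b\<le>M. if w a + w b = k then u i a * F a b * u j b else 0)"
    and K: "(\<Sum>a<N. w a) = K"
    and lead: "\<And>g. det (mat N N (\<lambda>(i, j). u j (g i))) \<noteq> 0 \<Longrightarrow>
        K \<le> (\<Sum>i<N. w (g i)) \<and> ((\<Sum>i<N. w (g i)) = K \<longrightarrow> g ` {..<N} = {..<N})"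
  shows "\<And>k. k < K \<Longrightarrow> fps_nth (pfaffian_sum N A) k = 0"
    and "fps_nth (pfaffian_sum N A) K = det (mat N N (\<lambda>(i, j). u j i)) * pfaffian_sum N F"
proof -
  let ?J = "{..M}" and ?D = "\<lambda>g. det (mat N N (\<lambda>(i, j). u j (g i)))"
  let ?PF = "\<lambda>g. \<Prod>k<N div 2. F (g (2 * k)) (g (2 * k + 1))"
  let ?U = "\<lambda>i a. fps_const (u i a) * fps_X ^ w a"
  \<comment> \<open>The truncated entries, in the form required by the expansion.\<close>
  define B where "B i j = (\<Sum>a\<in>?J. \<Sum>b\<in>?J. ?U i a * fps_const (F a b) * ?U j b)" for i j
  have const: "(\<Prod>i\<in>I. fps_const (f i)) = fps_const (\<Prod>i\<in>I. f i)" for f :: "nat \<Rightarrow> 'a" and I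
    by (induction I rule: infinite_finite_induct) auto
  have nth: "fps_nth (fps_const q * fps_X ^ e) k = (if e = k then q else 0)" for q :: 'a and e k
    by (simp add: fps_X_power_nth)
  have B: "fps_nth (B i j) k = (\<Sum>a\<le>M. \<Sum>b\<le>M. if w a + w b = k then u i a * F a b * u j b else 0)" for i j k
  proof -
    have "?U i a * fps_const (F a b) * ?U j b = fps_const (u i a * F a b * u j b) * fps_X ^ (w a + w b)" for a b
      by (simp add: power_add fps_const_mult[symmetric] mult_ac del: fps_const_mult)
    then show ?thesis unfolding B_def fps_sum_nth by (simp only: nth)
  qed
  have "agree_upto K (pfaffian_sum N A) (pfaffian_sum N B)"
    by (rule agree_upto_pfaffian_sum) (simp add: agree_upto_def A B)
  then have AB: "fps_nth (pfaffian_sum N A) k = fps_nth (pfaffian_sum N B) k" if "k \<le> K" for k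
    using that by (simp add: agree_upto_def)
  have "pfaffian_sum N B = (\<Sum>g\<in>{..<N} \<rightarrow>\<^sub>E ?J. fps_const (?PF g * ?D g) * fps_X ^ (\<Sum>i<N. w (g i)))"
    unfolding B_def[abs_def] pfaffian_sum_expand[OF finite_atMost N(1)] det_graded const
    by (simp only: mult.assoc[symmetric] fps_const_mult)
  then have P: "fps_nth (pfaffian_sum N B) k = (\<Sum>g\<in>{..<N} \<rightarrow>\<^sub>E ?J. if (\<Sum>i<N. w (g i)) = k then ?PF g * ?D g else 0)" for k
    by (simp only: fps_sum_nth nth)
  show "fps_nth (pfaffian_sum N A) k = 0" if "k < K" for k
  proof -
    have "(if (\<Sum>i<N. w (g i)) = k then ?PF g * ?D g else 0) = 0" for g
      using lead[of g] that by (cases "?D g = 0") auto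
    then show ?thesis using that by (simp add: AB P)
  qed
  let ?G = "{g \<in> {..<N} \<rightarrow>\<^sub>E ?J. g ` {..<N} = {..<N}}"
  have inj: "inj_on g {..<N}" if "g ` {..<N} = {..<N}" for g :: "nat \<Rightarrow> nat"
    using that by (intro eq_card_imp_inj_on) simp_all
  have "fps_nth (pfaffian_sum N A) K = (\<Sum>g\<in>{..<N} \<rightarrow>\<^sub>E ?J. if g ` {..<N} = {..<N} then ?PF g * ?D g else 0)"
    unfolding AB[OF order_refl] P
  proof (rule sum.cong[OF refl])
    fix g
    have "(\<Sum>i<N. w (g i)) = K" if g: "g ` {..<N} = {..<N}"
      using sum.reindex[OF inj[OF g], of w] by (simp add: g K)
    then show "(if (\<Sum>i<N. w (g i)) = K then ?PF g * ?D g else 0) =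
        (if g ` {..<N} = {..<N} then ?PF g * ?D g else 0)"
      using lead[of g] by (cases "?D g = 0") auto
  qed
  also have "\<dots> = (\<Sum>g\<in>?G. ?PF g * ?D g)"
    by (rule sum.inter_filter[symmetric]) (simp add: finite_PiE)
  also have "\<dots> = (\<Sum>p | p permutes {..<N}. ?PF p * ?D p)"
  proof (rule sum.reindex_bij_witness[where i = "\<lambda>p. restrict p {..<N}" and j = "\<lambda>g i. if i < N then g i else i"])
    fix g assume g: "g \<in> ?G"
    show "restrict (\<lambda>i. if i < N then g i else i) {..<N} = g"
      using g by (intro ext) (auto simp: restrict_def PiE_def extensional_def)
    have "bij_betw (\<lambda>i. if i < N then g i else i) {..<N} {..<N}"
      using g inj[of g] by (auto simp: bij_betw_def inj_on_def image_def)
    then show "(\<lambda>i. if i < N then g i else i) \<in> {p. p permutes {..<N}}"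
      unfolding mem_Collect_eq by (rule bij_imp_permutes) simp
    have "mat N N (\<lambda>(i, j). u j (if i < N then g i else i)) = mat N N (\<lambda>(i, j). u j (g i))"
      by (intro eq_matI) auto
    moreover have "?PF (\<lambda>i. if i < N then g i else i) = ?PF g"
      by (intro prod.cong) auto
    ultimately show "?PF (\<lambda>i. if i < N then g i else i) * ?D (\<lambda>i. if i < N then g i else i) = ?PF g * ?D g"
      by simp
  next
    fix p assume "p \<in> {p. p permutes {..<N}}"
    then have p: "p permutes {..<N}" by simp
    show "(\<lambda>i. if i < N then restrict p {..<N} i else i) = p"
      using permutes_not_in[OF p] by (intro ext) auto
    have "p i < N" if "i < N" for i using permutes_in_image[OF p, of i] that by simp
    then have "p i \<in> ?J" if "i < N" for i using that N(2) by fastforce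
    moreover have "restrict p {..<N} ` {..<N} = {..<N}" using permutes_image[OF p] by simp
    ultimately show "restrict p {..<N} \<in> ?G" by auto
  qed
  also have "\<dots> = (\<Sum>p | p permutes {..<N}. det (mat N N (\<lambda>(i, j). u j i)) * (of_int (sign p) * ?PF p))"
    by (intro sum.cong refl) (simp add: det_rows_permuted mult_ac)
  finally show "fps_nth (pfaffian_sum N A) K = det (mat N N (\<lambda>(i, j). u j i)) * pfaffian_sum N F"
    by (simp add: pfaffian_sum_def sum_distrib_left)
qed

text \<open>
  The matrix of powers of the nodes \<open>0, 1, 2, \<dots>\<close>, preceded by an identity block of size \<open>s\<close> for the
  border.
\<close>

definition node_power :: "nat \<Rightarrow> nat \<Rightarrow> nat \<Rightarrow> 'a::comm_ring_1" where
  "node_power s i a = (if i < s \<or> a < s then of_bool (i = a) else of_nat (i - s) ^ (a - s))"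

definition newton_poly :: "nat \<Rightarrow> 'a::idom poly" where
  "newton_poly i = (\<Prod>k<i. [:- of_nat k, 1:])"

lemma newton_poly:
  "degree (newton_poly i :: 'a::idom poly) = i" "coeff (newton_poly i :: 'a poly) i = 1"
  "poly (newton_poly i :: 'a poly) x = (\<Prod>k<i. x - of_nat k)"
proof -
  show d: "degree (newton_poly i :: 'a poly) = i"
    unfolding newton_poly_def by (simp add: degree_prod_eq_sum_degree)
  have "lead_coeff (newton_poly i :: 'a poly) = 1"
    unfolding newton_poly_def lead_coeff_prod by simp
  then show "coeff (newton_poly i :: 'a poly) i = 1" by (simp only: d)
  show "poly (newton_poly i :: 'a poly) x = (\<Prod>k<i. x - of_nat k)"
    by (simp add: newton_poly_def poly_prod)
qed

text \<open>
  The Vandermonde determinant: in the Newton basis of the polynomials the matrix is triangular.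
\<close>

lemma det_node_power:
  "det (mat (s + n) (s + n) (\<lambda>(i, j). node_power s j i :: 'a::idom)) =
     (\<Prod>i<n. \<Prod>k<i. of_nat i - of_nat k)"
proof -
  define L :: "nat \<Rightarrow> nat \<Rightarrow> 'a" where
    "L i a = (if i < s \<or> a < s then of_bool (i = a) else coeff (newton_poly (i - s)) (a - s))" for i a
  define T :: "nat \<Rightarrow> nat \<Rightarrow> 'a" where
    "T i j = (if i < s \<or> j < s then of_bool (i = j) else poly (newton_poly (i - s)) (of_nat (j - s)))" for i j
  have "det (mat (s + n) (s + n) (\<lambda>(i, j). node_power s j i :: 'a)) = (\<Prod>i<s + n. T i i)"
  proof (rule det_unitriangular_mult[of "s + n" L "node_power s" T])
    fix i j assume ij: "i < s + n" "j < s + n"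
    have split: "{..<s + n} = {..<s} \<union> {s..<s + n}" "{..<s} \<inter> {s..<s + n} = {}" by auto
    have "(\<Sum>a<s + n. L i a * node_power s j a) =
        (\<Sum>a<s. L i a * node_power s j a) + (\<Sum>a\<in>{s..<s + n}. L i a * node_power s j a)"
      unfolding split(1) by (rule sum.union_disjoint) auto
    also have "(\<Sum>a\<in>{s..<s + n}. L i a * node_power s j a) = (\<Sum>a<n. L i (a + s) * node_power s j (a + s))"
      by (rule sum.reindex_bij_witness[of _ "\<lambda>a. a + s" "\<lambda>a. a - s"]) auto
    also have "(\<Sum>a<s. L i a * node_power s j a) = (\<Sum>a<s. if a = i then of_bool (i = j) else 0)"
      by (intro sum.cong) (auto simp: L_def node_power_def)
    also have "(\<Sum>a<n. L i (a + s) * node_power s j (a + s)) = (if i < s \<or> j < s then 0 else poly (newton_poly (i - s)) (of_nat (j - s)))"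
    proof (cases "i < s \<or> j < s")
      case True
      then show ?thesis by (auto simp: L_def node_power_def intro!: sum.neutral)
    next
      case False
      have "poly (newton_poly (i - s) :: 'a poly) x = (\<Sum>a<n. coeff (newton_poly (i - s)) a * x ^ a)" for x
        unfolding poly_altdef newton_poly(1)
        by (rule sum.mono_neutral_left) (use False ij in \<open>auto intro!: coeff_eq_0 simp: newton_poly(1)\<close>)
      then show ?thesis using False by (simp add: L_def node_power_def)
    qed
    finally show "(\<Sum>a<s + n. L i a * node_power s j a) = T i j"
      by (auto simp: T_def)
  next
    fix i a :: nat assume "i < a"
    then show "L i a = 0" by (auto simp: L_def newton_poly(1) intro!: coeff_eq_0)
  next
    fix i j assume "j < i" "i < s + n"
    then have "(\<Prod>k<i - s. of_nat (j - s) - of_nat k) = (0::'a)" if "\<not> j < s"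
      using that by (intro prod_zero) (auto intro!: bexI[of _ "j - s"])
    then show "T i j = 0" using \<open>j < i\<close> by (auto simp: T_def newton_poly(3))
  qed (simp add: L_def newton_poly(2))
  also have "(\<Prod>i<s + n. T i i) = (\<Prod>i<n. \<Prod>k<i. of_nat i - of_nat k)"
  proof -
    have "(\<Prod>i<s. T i i) = 1" by (intro prod.neutral) (simp add: T_def)
    moreover have "(\<Prod>i<s + n. T i i) = (\<Prod>i<s. T i i) * (\<Prod>i<n. T (s + i) (s + i))"
      by (induction n) (simp_all add: mult.assoc)
    ultimately show ?thesis by (simp add: T_def newton_poly(3))
  qed
  finally show ?thesis .
qed

lemma vandermonde_prod_snoc: "vandermonde_prod (xs @ [x]) = vandermonde_prod xs * (\<Prod>y\<leftarrow>xs. x - y)"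
  by (induction xs) (simp_all add: mult_ac)

lemma vandermonde_prod_upt: "vandermonde_prod (map c [0..<n]) = (\<Prod>i<n. \<Prod>k<i. c i - c k)"
proof (induction n)
  case (Suc n)
  have "(\<Prod>y\<leftarrow>map c [0..<n]. c n - y) = (\<Prod>k<n. c n - c k)"
    using prod.distinct_set_conv_list[of "[0..<n]" "\<lambda>k. c n - c k"] by (simp add: lessThan_atLeast0 o_def)
  then show ?case using Suc by (simp add: vandermonde_prod_snoc)
qed simp

section \<open>The homogeneous limit\<close>

definition series_point :: "nat \<Rightarrow> rat fps" where
  "series_point c = fps_const (of_nat c) * fps_X"

text \<open>
  For a multiple \<open>c t\<close> of the variable the coefficient of index \<open>1\<close> recovers \<open>c\<close>.
\<close>

definition series_entry :: "rat fps \<Rightarrow> rat fps \<Rightarrow> rat fps" where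
  "series_entry x y = eval_line (fps_nth x 1) (fps_nth y 1) dsasm_gf"

lemma series_point_nth [simp]: "fps_nth (series_point c) 0 = 0" "fps_nth (series_point c) (Suc 0) = of_nat c"
  by (simp_all add: series_point_def)

lemma series_entry_skew: "series_entry x y = - series_entry y x"
proof (rule fps_ext)
  fix s
  let ?c = "fps_nth x 1" and ?d = "fps_nth y 1"
  have "(\<Sum>a\<le>s. coeff_uv a (s - a) dsasm_gf * ?c ^ a * ?d ^ (s - a)) =
      (\<Sum>a\<le>s. - (coeff_uv a (s - a) dsasm_gf * ?d ^ a * ?c ^ (s - a)))"
  proof (rule sum.reindex_bij_witness[of _ "\<lambda>a. s - a" "\<lambda>a. s - a"])
    fix a assume "a \<in> {..s}"
    then have "s - (s - a) = a" by simp
    moreover have "coeff_uv (s - a) a dsasm_gf = - coeff_uv a (s - a) dsasm_gf"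
      by (rule coeff_dsasm_gf_skew)
    ultimately show "- (coeff_uv (s - a) (s - (s - a)) dsasm_gf * ?d ^ (s - a) * ?c ^ (s - (s - a))) =
        coeff_uv a (s - a) dsasm_gf * ?c ^ a * ?d ^ (s - a)"
      by (simp only: mult_minus_left minus_minus mult_ac)
  qed auto
  then show "fps_nth (series_entry x y) s = fps_nth (- series_entry y x) s"
    by (simp add: series_entry_def eval_line_def sum_negf)
qed

instance fps :: (ring_char_0) ring_char_0 ..

text \<open>
  All points have constant term \<open>0\<close>, whereas \<open>1 - x\<close>, \<open>-1\<close>, \<open>2\<close> and \<open>1 - y + x y\<close> do not.
\<close>

interpretation series_points: generic_points "range series_point" series_entry
proof (rule generic_points.intro)
  have nth: "fps_nth z 0 = 0" if "z \<in> range series_point" for z using that by auto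
  show "series_entry x y * pair_den x y = pair_num x y"
    if "x \<in> range series_point" "y \<in> range series_point" for x y
  proof -
    obtain c d where "x = series_point c" "y = series_point d" using \<open>x \<in> _\<close> \<open>y \<in> _\<close> by auto
    then show ?thesis
      using eval_line_dsasm_gf[of "of_nat c" "of_nat d"]
      unfolding series_point_def[symmetric]
      by (simp add: series_entry_def pair_den_def pair_num_def)
  qed
  show "series_entry x y = - series_entry y x" for x y by (rule series_entry_skew)
  show "1 - x \<notin> range series_point" if "x \<in> range series_point" for x
    using nth[of x] nth[of "1 - x"] that by auto
  show "- 1 \<notin> range series_point" using nth[of "- 1"] by auto
  show "2 \<notin> range series_point" using nth[of 2] by auto
  show "1 - y + x * y \<noteq> 0" if "x \<in> range series_point" "y \<in> range series_point" for x y
  proof -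
    have "fps_nth (1 - y + x * y) 0 = 1" using nth that by simp
    then show ?thesis by (metis fps_zero_nth zero_neq_one)
  qed
qed

lemma series_points_eq: "pfaffian_identity series_entry (map series_point [0..<n])"
proof (rule series_points.pfaffian_identity_generic)
  have "inj series_point" by (rule injI) (metis of_nat_eq_iff series_point_nth(2))
  then show "distinct (map series_point [0..<n])" by (simp add: distinct_map inj_on_subset[OF _ subset_UNIV])
qed auto

lemma partition_fn_nth_0: "fps_nth (partition_fn xs) 0 = partition_fn (map (\<lambda>x. fps_nth x 0) xs)"
proof -
  let ?h = "\<lambda>x::'a fps. fps_nth x 0"
  have row: "fps_nth (row_transfer x h ys F bs) 0 = row_transfer (?h x) h (map ?h ys) (\<lambda>w. ?h (F w)) bs" for x h ys F bs
    by (induction x h ys F bs rule: row_transfer.induct) (simp_all add: turn_factor_def power2_eq_square)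
  have "?h (triangle_weight xs bs) = triangle_weight (map ?h xs) bs" for bs
    by (induction xs bs rule: triangle_weight.induct) (simp_all add: row diag_weight_def turn_factor_def power2_eq_square)
  then show ?thesis by (simp add: partition_fn_def)
qed

lemma den_prod_nth_0: "(\<And>x. x \<in> set xs \<Longrightarrow> fps_nth x 0 = 0) \<Longrightarrow> fps_nth (den_prod xs) 0 = 1"
  for xs :: "'a::comm_ring_1 fps list"
proof (induction xs)
  case (Cons x xs)
  have "fps_nth (\<Prod>y\<leftarrow>ys. pair_den x y) 0 = 1" if "set ys \<subseteq> set xs" for ys
    using that by (induction ys) (simp_all add: pair_den_def Cons.prems)
  then show ?case using Cons by simp
qed simp

lemma vandermonde_prod_series_points:
  "vandermonde_prod (map series_point [0..<n]) = fps_const (\<Prod>i<n. \<Prod>k<i. of_nat i - of_nat k) * fps_X ^ (\<Sum>i<n. i)"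
proof -
  have d: "series_point i - series_point k = fps_const (of_nat i - of_nat k) * fps_X" for i k
    by (simp add: series_point_def left_diff_distrib fps_const_sub[symmetric] del: fps_const_sub)
  have const: "(\<Prod>i\<in>I. fps_const (f i)) = fps_const (\<Prod>i\<in>I. f i)" for f :: "nat \<Rightarrow> rat" and I
    by (induction I rule: infinite_finite_induct) auto
  show ?thesis
    unfolding vandermonde_prod_upt d prod.distrib const by (simp add: power_sum)
qed


text \<open>
  The coefficient matrix of the bordered kernel.  A row of ones is the series \<open>1\<close> in every parameter,
  so after the expansion only its entry at the exponent \<open>0\<close>, that is at the index \<open>s\<close>, remains.
\<close>

definition bordered_entry :: "nat \<Rightarrow> (nat \<Rightarrow> nat \<Rightarrow> 'a) \<Rightarrow> nat \<Rightarrow> nat \<Rightarrow> 'a::comm_ring_1" where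
  "bordered_entry s F a b =
     (if s \<le> a \<and> s \<le> b then F (a - s) (b - s)
      else if a < s \<and> b = s then 1 else if a = s \<and> b < s then - 1 else 0)"

abbreviation (input) gf_coeff :: "nat \<Rightarrow> nat \<Rightarrow> rat" where
  "gf_coeff i j \<equiv> coeff_uv i j dsasm_gf"

lemma series_entry_nth:
  "fps_nth (series_entry (series_point i) (series_point j)) k =
     (\<Sum>a\<le>k. of_nat i ^ a * gf_coeff a (k - a) * of_nat j ^ (k - a))"
  by (simp add: series_entry_def eval_line_def mult_ac)

lemma triangular_double_sum:
  fixes f :: "nat \<Rightarrow> nat \<Rightarrow> 'a::comm_monoid_add"
  assumes "k \<le> M"
  shows "(\<Sum>a\<le>M. \<Sum>b\<le>M. if a + b = k then f a b else 0) = (\<Sum>a\<le>k. f a (k - a))"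
proof -
  have "(\<Sum>b\<le>M. if a + b = k then f a b else 0) = (if a \<le> k then f a (k - a) else 0)" for a
  proof (cases "a \<le> k")
    case True
    then have "(\<Sum>b\<le>M. if a + b = k then f a b else 0) = (\<Sum>b\<le>M. if b = k - a then f a b else 0)"
      by (intro sum.cong) auto
    moreover have "k - a \<le> M" using assms by simp
    ultimately show ?thesis using True by simp
  qed simp
  then have "(\<Sum>a\<le>M. \<Sum>b\<le>M. if a + b = k then f a b else 0) = (\<Sum>a\<le>M. if a \<le> k then f a (k - a) else 0)"
    by simp
  also have "\<dots> = (\<Sum>a\<in>{a\<in>{..M}. a \<le> k}. f a (k - a))"
    by (rule sum.inter_filter[symmetric]) simp
  also have "{a\<in>{..M}. a \<le> k} = {..k}" using assms by auto
  finally show ?thesis .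
qed

text \<open>
  With the border occupying index \<open>0\<close> if \<open>s = 1\<close>, the index \<open>a\<close> stands for the exponent \<open>a - s\<close>; the
  truncated subtraction gives the border the exponent \<open>0\<close>.
\<close>

lemma point_kernel_nth:
  assumes "i < s + n" "j < s + n" "k \<le> M" "s \<le> 1"
  defines "L \<equiv> replicate s Border @ map Pt (map series_point [0..<n])"
  shows "fps_nth (base_kernel series_entry (L ! i) (L ! j)) k =
    (\<Sum>a\<le>Suc M. \<Sum>b\<le>Suc M. if (a - s) + (b - s) = k
       then node_power s i a * bordered_entry s gf_coeff a b * node_power s j b else 0)"
proof (cases "s = 0")
  case True
  then have "L ! i = Pt (series_point i)" "L ! j = Pt (series_point j)"
    using assms(1,2) by (simp_all add: L_def)
  then have "fps_nth (base_kernel series_entry (L ! i) (L ! j)) k =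
     (\<Sum>a\<le>k. of_nat i ^ a * gf_coeff a (k - a) * of_nat j ^ (k - a))"
    by (simp add: series_entry_nth)
  moreover have "\<dots> = (\<Sum>a\<le>Suc M. \<Sum>b\<le>Suc M. if a + b = k then of_nat i ^ a * gf_coeff a b * of_nat j ^ b else 0)"
    using assms(3) by (subst triangular_double_sum) simp_all
  moreover have "node_power s = (\<lambda>i a. of_nat i ^ a :: rat)" "bordered_entry s gf_coeff = gf_coeff"
    using True by (simp_all add: node_power_def bordered_entry_def fun_eq_iff)
  ultimately show ?thesis using True by (simp del: sum.atMost_Suc cong: if_cong)
next
  case False
  then have s: "s = 1" using assms(4) by simp
  have shift: "(\<Sum>a\<le>Suc M. \<Sum>b\<le>Suc M. h a b) =
      h 0 0 + (\<Sum>b\<le>M. h 0 (Suc b)) + (\<Sum>a\<le>M. h (Suc a) 0) + (\<Sum>a\<le>M. \<Sum>b\<le>M. h (Suc a) (Suc b))" for h :: "nat \<Rightarrow> nat \<Rightarrow> rat"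
    by (simp add: sum.atMost_Suc_shift sum.distrib del: sum.atMost_Suc)
  have at: "L ! 0 = Border" "\<And>i. i < n \<Longrightarrow> L ! Suc i = Pt (series_point i)"
    by (simp_all add: L_def s)
  show ?thesis
  proof (cases i; cases j)
    assume "i = 0" "j = 0"
    then show ?thesis
      by (simp only: shift) (simp add: at s node_power_def bordered_entry_def cong: if_cong)
  next
    fix j' assume ij: "i = 0" "j = Suc j'"
    then have "L ! j = Pt (series_point j')" using at assms by (simp add: s)
    then show ?thesis unfolding shift using ij
      by (simp add: at s node_power_def bordered_entry_def cong: if_cong)
  next
    fix i' assume ij: "i = Suc i'" "j = 0"
    then have "L ! i = Pt (series_point i')" using at assms by (simp add: s)
    then show ?thesis unfolding shift using ij
      by (simp add: at s node_power_def bordered_entry_def cong: if_cong)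
  next
    fix i' j' assume ij: "i = Suc i'" "j = Suc j'"
    then have L: "L ! Suc i' = Pt (series_point i')" "L ! Suc j' = Pt (series_point j')" using at assms by (simp_all add: s)
    have "(\<Sum>a\<le>M. \<Sum>b\<le>M. if a + b = k then of_nat i' ^ a * gf_coeff a b * of_nat j' ^ b else 0) =
       (\<Sum>a\<le>k. of_nat i' ^ a * gf_coeff a (k - a) * of_nat j' ^ (k - a))"
      using assms(3) by (rule triangular_double_sum)
    then show ?thesis unfolding shift using ij
      by (simp add: L s node_power_def bordered_entry_def series_entry_nth cong: if_cong)
  qed
qed

text \<open>
  A nonzero determinant needs distinct rows and, because of the border column, the row \<open>0\<close>.  Hence the
  sum of the exponents is minimal exactly for the smallest possible exponents.
\<close>

lemma det_node_power_nonzero: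
  assumes "det (mat (s + n) (s + n) (\<lambda>(i, j). node_power s j (g i) :: rat)) \<noteq> 0" "s \<le> 1"
  shows "(\<Sum>i<n. i) \<le> (\<Sum>i<s + n. g i - s)"
    and "(\<Sum>i<s + n. g i - s) = (\<Sum>i<n. i) \<Longrightarrow> g ` {..<s + n} = {..<s + n}"
proof -
  let ?N = "s + n" and ?B = "g ` {..<s + n}"
  let ?A = "mat ?N ?N (\<lambda>(i, j). node_power s j (g i) :: rat)"
  have inj: "inj_on g {..<?N}"
  proof (rule inj_onI, rule ccontr)
    fix i j assume ij: "i \<in> {..<?N}" "j \<in> {..<?N}" "g i = g j" "i \<noteq> j"
    then have "det ?A = 0"
      by (intro det_identical_rows[of ?A ?N i j]) (auto intro!: eq_vecI)
    then show False using assms(1) by simp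
  qed
  have zero: "0 \<in> ?B" if "s = 1"
  proof (rule ccontr)
    assume no: "0 \<notin> ?B"
    have "(\<Prod>i<?N. node_power s (\<sigma> i) (g i) :: rat) = 0" if \<sigma>: "\<sigma> permutes {..<?N}" for \<sigma>
    proof -
      obtain i where i: "\<sigma> i = 0" using permutes_surj[OF \<sigma>] unfolding surj_def by metis
      then have "i < ?N" using permutes_in_image[OF \<sigma>, of i] \<open>s = 1\<close> by simp
      then have "node_power s (\<sigma> i) (g i) = (0::rat)"
        using no i \<open>s = 1\<close> by (auto simp: node_power_def)
      then show ?thesis using \<open>i < ?N\<close> by (intro prod_zero) auto
    qed
    then have "det ?A = 0" unfolding det_transversal by (intro sum.neutral) simp
    then show False using assms(1) by simp
  qed
  have card: "card ?B = ?N" by (simp add: card_image[OF inj])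
  have sum: "(\<Sum>i<?N. g i - s) = (\<Sum>a\<in>?B. a - s)"
    using sum.reindex[OF inj, of "\<lambda>a. a - s"] by simp
  have key: "(\<Sum>a\<in>?B. a - s) + s * n = \<Sum>?B \<and> (\<Sum>i<n. i) + s * n = \<Sum>{..<?N}"
  proof (cases "s = 0")
    case False
    then have s: "s = 1" using assms(2) by simp
    have "\<Sum>?B = (\<Sum>a\<in>?B - {0}. a)" by (rule sum.mono_neutral_right) auto
    also have "\<dots> = (\<Sum>a\<in>?B - {0}. (a - 1) + 1)" by (intro sum.cong) auto
    also have "\<dots> = (\<Sum>a\<in>?B - {0}. a - 1) + card (?B - {0})" by (simp only: sum.distrib card_eq_sum)
    also have "card (?B - {0}) = n" using zero[OF s] card s by simp
    also have "(\<Sum>a\<in>?B - {0}. a - 1) = (\<Sum>a\<in>?B. a - 1)" by (rule sum.mono_neutral_left) auto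
    finally have 1: "\<Sum>?B = (\<Sum>a\<in>?B. a - s) + s * n" by (simp add: s)
    have "\<Sum>{..<Suc n} = (\<Sum>i<n. Suc i)" by (simp add: sum.lessThan_Suc_shift del: sum.lessThan_Suc)
    also have "\<dots> = (\<Sum>i<n. i) + n" by (simp add: sum_Suc)
    finally show ?thesis using 1 by (simp add: s)
  qed simp
  have B: "\<Sum>{..<?N} \<le> \<Sum>?B" "\<Sum>?B = \<Sum>{..<?N} \<Longrightarrow> ?B = {..<?N}"
    using card_le_sum_nats[of ?B] card by simp_all
  show "(\<Sum>i<n. i) \<le> (\<Sum>i<?N. g i - s)" unfolding sum using key B(1) by linarith
  show "?B = {..<?N}" if "(\<Sum>i<?N. g i - s) = (\<Sum>i<n. i)"
    using that key B(2) unfolding sum by simp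
qed

text \<open>
  Comparison of the coefficients of \<open>t\<close> to the power \<open>n (n - 1) / 2\<close> in the Pfaffian formula at the
  points \<open>0, t, 2 t, \<dots>, (n - 1) t\<close>.
\<close>

theorem DSASM_pfaffian_sum:
  "of_nat (pairings n) * of_nat (card (DSASM n)) =
     pfaffian_sum (n mod 2 + n) (bordered_entry (n mod 2) gf_coeff)"
proof -
  define s where "s = n mod 2"
  define K where "K = (\<Sum>i<n. i)"
  define V :: rat where "V = (\<Prod>i<n. \<Prod>k<i. of_nat i - of_nat k)"
  define xs where "xs = map series_point [0..<n]"
  define L where "L = replicate s Border @ map Pt xs"
  define A where "A i j = base_kernel series_entry (L ! i) (L ! j)" for i j
  have s: "s \<le> 1" "even (s + n)" by (auto simp: s_def)
  have V: "V \<noteq> 0" by (simp add: V_def)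
  have "border n = (replicate s Border :: rat fps point list)"
    by (auto simp: border_def s_def odd_iff_mod_2_eq_one even_iff_mod_2_eq_zero)
  then have P: "pf_points series_entry xs = pfaffian_sum (s + n) A"
    by (simp add: pf_points_def pf_list_def A_def[abs_def] L_def xs_def)
  have lead: "K \<le> (\<Sum>i<s + n. g i - s) \<and> ((\<Sum>i<s + n. g i - s) = K \<longrightarrow> g ` {..<s + n} = {..<s + n})"
    if "det (mat (s + n) (s + n) (\<lambda>(i, j). node_power s j (g i) :: rat)) \<noteq> 0" for g
    using det_node_power_nonzero[OF that s(1)] by (simp add: K_def)
  have wK: "(\<Sum>a<s + n. a - s) = K"
  proof -
    have "(\<Sum>a<s + n. a - s) = (\<Sum>a<s. a - s) + (\<Sum>a<n. s + a - s)"
      by (induction n) simp_all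
    then show ?thesis by (simp add: K_def)
  qed
  have nth: "fps_nth (A i j) k = (\<Sum>a\<le>Suc (K + n). \<Sum>b\<le>Suc (K + n). if (a - s) + (b - s) = k
       then node_power s i a * bordered_entry s gf_coeff a b * node_power s j b else 0)"
    if "i < s + n" "j < s + n" "k \<le> K" for i j k
    unfolding A_def L_def xs_def by (rule point_kernel_nth) (use that s in auto)
  note leading = pfaffian_sum_leading_coeff[where w = "\<lambda>a. a - s", OF s(2) _ nth wK lead]
  have low: "fps_nth (pfaffian_sum (s + n) A) k = 0" if "k < K" for k
    by (rule leading(1)[OF _ _ _ _ _ that]) (use s in auto)
  have top: "fps_nth (pfaffian_sum (s + n) A) K = V * pfaffian_sum (s + n) (bordered_entry s gf_coeff)"
    by (subst leading(2)) (use s in \<open>auto simp: det_node_power V_def\<close>)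
  have eq: "of_nat (pairings n) * partition_fn xs * vandermonde_prod xs = den_prod xs * pfaffian_sum (s + n) A"
    using series_points_eq[of n] P by (simp add: pfaffian_identity_def xs_def)
  have "fps_nth (of_nat (pairings n) * partition_fn xs * vandermonde_prod xs) K = of_nat (pairings n) * of_nat (card (DSASM n)) * V"
  proof -
    have v: "vandermonde_prod xs = fps_const V * fps_X ^ K"
      by (simp add: xs_def vandermonde_prod_series_points V_def K_def)
    have "fps_nth (f * vandermonde_prod xs) K = fps_nth f 0 * V" for f
      unfolding v mult.assoc[symmetric] by (simp add: fps_X_power_mult_right_nth)
    moreover have "fps_nth (partition_fn xs) 0 = of_nat (card (DSASM n))"
      by (simp add: partition_fn_nth_0 card_DSASM xs_def o_def map_replicate_const)
    ultimately show ?thesis by simp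
  qed
  moreover have "fps_nth (den_prod xs * pfaffian_sum (s + n) A) K = fps_nth (pfaffian_sum (s + n) A) K"
  proof -
    have d0: "fps_nth (den_prod xs) 0 = 1"
      by (rule den_prod_nth_0) (auto simp: xs_def)
    have "fps_nth (den_prod xs * pfaffian_sum (s + n) A) K =
        (\<Sum>i=0..K. if i = 0 then fps_nth (pfaffian_sum (s + n) A) K else 0)"
      unfolding fps_mult_nth
    proof (rule sum.cong[OF refl])
      fix i
      show "fps_nth (den_prod xs) i * fps_nth (pfaffian_sum (s + n) A) (K - i) =
          (if i = 0 then fps_nth (pfaffian_sum (s + n) A) K else 0)" if "i \<in> {0..K}"
        using d0 low[of "K - i"] that by auto
    qed
    then show ?thesis by simp
  qed
  ultimately have "of_nat (pairings n) * of_nat (card (DSASM n)) * V =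
      V * pfaffian_sum (s + n) (bordered_entry s gf_coeff)"
    using eq top by auto
  then show ?thesis using V by (simp add: s_def)
qed

text \<open>
  The normalised Pfaffian on an interval of indices, shifted to start at \<open>0\<close>.
\<close>

lemma Pf_eq_pfaffian_sum:
  fixes F :: "nat \<Rightarrow> nat \<Rightarrow> 'a::field_char_0"
  assumes skew: "\<And>i j. F i j = - F j i" and range: "{a..b} = {a..<a + N}" and N: "even N"
  shows "Pf a b F = pfaffian_sum N (\<lambda>i j. F (i + a) (j + a)) / (2 ^ (N div 2) * fact (N div 2))"
proof -
  have "skew_extension F i j = F i j" for i j
  proof -
    have "F i i + F i i = 0" using skew[of i i] by (metis add.right_inverse)
    then have "2 * F i i = 0" by (simp only: mult_2)
    then have "F i i = 0" by simp
    then show ?thesis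
      by (cases i j rule: linorder_cases) (auto simp: skew_extension_def intro: skew[symmetric])
  qed
  then have "skew_extension F = F" by (intro ext)
  moreover have "(\<Sum>\<sigma> | \<sigma> permutes {a..<a + N}. of_int (sign \<sigma>) *
        (\<Prod>k<N div 2. F (\<sigma> (2 * k + a)) (\<sigma> (2 * k + 1 + a)))) =
      (\<Sum>\<sigma> | \<sigma> permutes {..<N}. of_int (sign \<sigma>) * (\<Prod>k<N div 2. F (\<sigma> (2 * k) + a) (\<sigma> (2 * k + 1) + a)))"
    by (rule sum_permutes_shift) (auto intro!: prod.cong)
  ultimately show ?thesis
    using N by (simp add: Pf_def pfaffian_def range Let_def pfaffian_sum_def ac_simps)
qed

theorem corollary4p2:
  fixes n :: nat
  assumes "n > 0"
  shows "(of_nat (card (DSASM n)) :: rat) =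
           Pf (chi_odd n) (n - 1) (\<lambda>i j. coeff_uv i j dsasm_gf) \<and>
         (\<forall>i j. i < j \<longrightarrow>
           coeff_uv i j dsasm_gf =
             (\<Sum>k=0..i. (3 - kronecker_delta k 0) *
                (of_nat ((i + j - 2 * k - 1) choose (i - k))
                 - of_nat ((i + j - 2 * k - 1) choose (j - k)))) \<and>
           coeff_uv i j dsasm_gf =
             (of_nat j - of_nat i) *
             (\<Sum>k=0..i. (3 - kronecker_delta k 0) / of_nat (i + j - 2 * k) *
                of_nat ((i + j - 2 * k) choose (i - k))))"
proof (intro conjI allI impI)
  show "(of_nat (card (DSASM n)) :: rat) = Pf (chi_odd n) (n - 1) (\<lambda>i j. coeff_uv i j dsasm_gf)"
  proof (cases "even n")
    case True
    have "pfaffian_sum n (bordered_entry 0 gf_coeff) = of_nat (pairings n) * of_nat (card (DSASM n))"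
      using DSASM_pfaffian_sum[of n] True by (simp add: even_iff_mod_2_eq_zero)
    moreover have "bordered_entry 0 gf_coeff = gf_coeff"
      by (simp add: bordered_entry_def fun_eq_iff)
    moreover have "Pf 0 (n - 1) gf_coeff = pfaffian_sum n gf_coeff / (2 ^ (n div 2) * fact (n div 2))"
      using Pf_eq_pfaffian_sum[of gf_coeff 0 "n - 1" n, OF coeff_dsasm_gf_skew _ True] assms by fastforce
    ultimately show ?thesis using True by (simp add: chi_odd_def pairings_def)
  next
    case False
    \<comment> \<open>The only nonzero entry of the first row is the one at index \<open>1\<close>; removing both indices leaves the coefficients with indices from \<open>1\<close>.\<close>
    let ?B = "bordered_entry 1 gf_coeff"
    have "?B i j = - ?B j i" for i j
      by (cases i; cases j) (auto simp: bordered_entry_def intro: coeff_dsasm_gf_skew)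
    note B_skew = this
    have "pfaffian_sum (Suc n) ?B = (\<Sum>j\<in>{1..<Suc n}. ?B 0 j * pfaffian_cofactor (Suc n) ?B j)"
      using False by (intro pfaffian_sum_expand_first[OF _ _ B_skew]) simp_all
    also have "\<dots> = (\<Sum>j\<in>{1..<Suc n}. if j = 1 then pfaffian_cofactor (Suc n) ?B 1 else 0)"
      by (intro sum.cong) (auto simp: bordered_entry_def)
    also have "\<dots> = pfaffian_cofactor (Suc n) ?B 1"
      by (subst sum.delta) (use assms in auto)
    also have "\<dots> = of_nat (Suc n) * pfaffian_sum (n - 1) (\<lambda>i j. ?B (i + 2) (j + 2))"
      using False by (subst pfaffian_cofactor_1) simp_all
    also have "(\<lambda>i j. ?B (i + 2) (j + 2)) = (\<lambda>i j. gf_coeff (i + 1) (j + 1))"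
      by (simp add: bordered_entry_def)
    finally have "of_nat (pairings n) * of_nat (card (DSASM n)) =
        of_nat (Suc n) * pfaffian_sum (n - 1) (\<lambda>i j. gf_coeff (i + 1) (j + 1))"
      using DSASM_pfaffian_sum[of n] False by (simp add: odd_iff_mod_2_eq_one)
    moreover define q :: nat where "q = 2 ^ ((n - 1) div 2) * fact ((n - 1) div 2)"
    moreover have "pairings n = Suc n * q"
      using False by (auto simp: pairings_def q_def algebra_simps elim!: oddE)
    ultimately have "of_nat (Suc n) * (of_nat q * of_nat (card (DSASM n))) =
        of_nat (Suc n) * pfaffian_sum (n - 1) (\<lambda>i j. gf_coeff (i + 1) (j + 1))"
      by (simp only: of_nat_mult mult.assoc)
    then have P: "of_nat q * of_nat (card (DSASM n)) = pfaffian_sum (n - 1) (\<lambda>i j. gf_coeff (i + 1) (j + 1))"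
      by (simp only: mult_cancel_left of_nat_eq_0_iff nat.distinct simp_thms)
    have "Pf 1 (n - 1) gf_coeff = pfaffian_sum (n - 1) (\<lambda>i j. gf_coeff (i + 1) (j + 1)) / of_nat q"
      using Pf_eq_pfaffian_sum[of gf_coeff 1 "n - 1" "n - 1", OF coeff_dsasm_gf_skew] assms False
      unfolding q_def by fastforce
    then have "Pf 1 (n - 1) gf_coeff = of_nat (card (DSASM n))"
      unfolding P[symmetric] by (simp add: q_def)
    then show ?thesis using False by (simp add: chi_odd_def)
  qed
qed (rule coeff_dsasm_gf_explicit; assumption)+

end
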